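(* Let $T=(1,2,\ldots,d,t_d=t,0)$ with $d\ge t\ge 1$, set $s=d+1-t$, and let $P$ be a partition of diagonal lengths $T$ and difference-one hook code $\mathfrak Q(P)=(h_1^{l_1},\ldots,h_n^{l_n})$, where $s\ge h_1>h_2>\cdots>h_n\ge 0$ and $l_1,\ldots,l_n\ge 1$. For $k=1,\ldots,n$ let $\tau_k=\sum_{i=k}^n l_i-h_k$. Then $$\kappa(P)=s+\max\{t+1-s,\;0,\;\tau_1,\ldots,\tau_n\}.$$
   Context: Let $R=\mathsf k[x,y]$ with its standard grading, where the field $\mathsf k$ has characteristic zero, or is infinite of characteristic $p$ greater than the socle degree $d$ of $T$. For a partition $P=(p_1\ge\cdots\ge p_m)$ let $C_P$ be the set of monomials $x^ay^b$ with $0\le b<m$, $0\le a<p_{b+1}$ (Ferrers diagram), and $E_P$ the set of monomials not in $C_P$, and also the monomial ideal they generate. The diagonal lengths of $P$ is the Hilbert function of $R/E_P$. The initial monomial of a form is its monomial of highest $y$-degree with nonzero coefficient; $\mathrm{in}(I)$ is generated by the initial monomials of elements of $I$; the Jordan cell $\mathbb V(E_P)$ is the affine variety (an affine space) parametrizing all graded ideals $I\subset R$ with $\mathrm{in}(I)=E_P$. $\kappa(P)$ is the minimum number of generators of a generic ideal $I\in\mathbb V(E_P)$ (i.e. for all $I$ in a suitable nonempty Zariski-open dense subset). Hook code. A hook of $P$ consists of a corner $c\in C_P$, an arm $c,xc,\ldots,\nu=x^{u-1}c$ and a leg $c,yc,\ldots,\mu=y^{v-1}c$ in $C_P$ with $x\nu\in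 E_P$, $y\mu\in E_P$; $\nu$ is its hand, $\mu$ its foot, and it is a difference-one hook if $u-v=1$. For $T$ as in the claim, every degree-$d$ monomial of $C_P$ is the hand of a hook, and there are $t$ of them; order them by increasing $y$-degree ($x^d<x^{d-1}y<\cdots<y^d$). The hook code $\mathfrak Q(P)$ is the sequence of $t$ integers whose $k$-th entry is the number of difference-one hooks of $P$ having the $k$-th of these monomials as hand. It is a non-increasing sequence with entries in $[0,s]$, written $(h_1^{l_1},\ldots,h_n^{l_n})$ with the $h_i$ distinct and $l_i$ the multiplicity of $h_i$, so $\sum l_i=t$. *)

theory Defs
  imports "HOL-Analysis.Analysis" "HOL-Library.Poly_Mapping" "HOL-Library.Product_Plus"
begin

section \<open>The polynomial ring in two variables\<close>

text \<open>The polynomial ring \<open>k[x,y]\<close> is the monoid algebra of \<open>\<nat> \<times> \<nat>\<close>, with the convolution product of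
  \<open>Poly_Mapping\<close>: the pair \<open>(a, b)\<close> stands for the monomial \<open>x\<^sup>a y\<^sup>b\<close>.\<close>

type_synonym monomial = "nat \<times> nat"
type_synonym 'k poly2 = "monomial \<Rightarrow>\<^sub>0 'k"

abbreviation monom2 :: "monomial \<Rightarrow> 'k::field poly2" where
  "monom2 m \<equiv> Poly_Mapping.single m 1"

definition scale2 :: "'k::field \<Rightarrow> 'k poly2 \<Rightarrow> 'k poly2" where
  "scale2 c f = Poly_Mapping.single 0 c * f"

global_interpretation poly2: vector_space "scale2 :: 'k::field \<Rightarrow> 'k poly2 \<Rightarrow> 'k poly2"
proof
  fix a b :: 'k and f g :: "'k poly2"
  show "scale2 a (f + g) = scale2 a f + scale2 a g"
    by (simp add: scale2_def distrib_left)
  show "scale2 (a + b) f = scale2 a f + scale2 b f"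
    by (simp add: scale2_def single_add distrib_right)
  show "scale2 a (scale2 b f) = scale2 (a * b) f"
    by (simp add: scale2_def mult_single flip: mult.assoc)
  show "scale2 1 f = f"
    by (simp add: scale2_def)
qed

text \<open>Ideals are submodules: \<open>ideal.subspace I\<close> says that \<open>I\<close> is an ideal, and \<open>ideal.span G\<close> is the
  ideal generated by \<open>G\<close>.\<close>

global_interpretation ideal: module "(*) :: 'k::field poly2 \<Rightarrow> 'k poly2 \<Rightarrow> 'k poly2"
  by unfold_locales (simp_all add: distrib_left distrib_right mult.assoc)

definition forms :: "nat \<Rightarrow> 'k::field poly2 set" where
  "forms i = {f. \<forall>(a, b) \<in> Poly_Mapping.keys f. a + b = i}"

definition graded_ideal :: "'k::field poly2 set \<Rightarrow> bool" where
  "graded_ideal I \<longleftrightarrow> ideal.subspace I \<and> I = ideal.span (I \<inter> (\<Union>i. forms i))"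

text \<open>For a graded ideal \<open>I\<close>, the dimension of the degree-\<open>i\<close> component of \<open>R/I\<close>.\<close>

definition hilbert_function :: "'k::field poly2 set \<Rightarrow> nat \<Rightarrow> nat" where
  "hilbert_function I i =
     poly2.dim (forms i :: 'k poly2 set) - poly2.dim (I \<inter> forms i)"

definition num_gens :: "'k::field poly2 set \<Rightarrow> nat" where
  "num_gens I = (LEAST n. \<exists>G. finite G \<and> card G = n \<and> ideal.span G = I)"

text \<open>Only meant for a nonzero form, whose monomials have pairwise different \<open>y\<close>-degrees.\<close>

definition initial_monomial :: "'k::field poly2 \<Rightarrow> monomial" where
  "initial_monomial f = arg_max_on snd (Poly_Mapping.keys f)"

definition initial_ideal :: "'k::field poly2 set \<Rightarrow> 'k poly2 set" where
  "initial_ideal I =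
     ideal.span {monom2 (initial_monomial f) | f i. f \<in> I \<and> f \<in> forms i \<and> f \<noteq> 0}"


section \<open>Partitions and hooks\<close>

text \<open>The list \<open>P\<close> is indexed from 0, so the part usually written \<open>p\<^bsub>b+1\<^esub>\<close> is \<open>P ! b\<close>.\<close>

definition is_partition :: "nat list \<Rightarrow> bool" where
  "is_partition P \<longleftrightarrow> sorted_wrt (\<ge>) P \<and> (\<forall>p \<in> set P. 0 < p)"

definition cells :: "nat list \<Rightarrow> monomial set" where
  "cells P = {(a, b). b < length P \<and> a < P ! b}"

definition E_ideal :: "nat list \<Rightarrow> 'k::field poly2 set" where
  "E_ideal P = ideal.span (monom2 ` (- cells P))"

definition diagonal_lengths :: "'k::field itself \<Rightarrow> nat list \<Rightarrow> nat \<Rightarrow> nat" where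
  "diagonal_lengths _ P = hilbert_function (E_ideal P :: 'k poly2 set)"

text \<open>\<open>is_hook P c u v\<close>: the hook with corner \<open>c\<close> has arm length \<open>u\<close> and leg length \<open>v\<close>, both counting
  the corner; \<open>hook_hand c u\<close> is its hand.\<close>

definition is_hook :: "nat list \<Rightarrow> monomial \<Rightarrow> nat \<Rightarrow> nat \<Rightarrow> bool" where
  "is_hook P c u v \<longleftrightarrow> 1 \<le> u \<and> 1 \<le> v \<and>
     (\<forall>i<u. c + (i, 0) \<in> cells P) \<and> c + (u, 0) \<notin> cells P \<and>
     (\<forall>j<v. c + (0, j) \<in> cells P) \<and> c + (0, v) \<notin> cells P"

definition hook_hand :: "monomial \<Rightarrow> nat \<Rightarrow> monomial" where
  "hook_hand c u = c + (u - 1, 0)"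

definition num_diff_one_hooks :: "nat list \<Rightarrow> monomial \<Rightarrow> nat" where
  "num_diff_one_hooks P \<nu> =
     card {(c, u, v). is_hook P c u v \<and> hook_hand c u = \<nu> \<and> int u - int v = 1}"

definition hook_code :: "nat \<Rightarrow> nat list \<Rightarrow> nat list" where
  "hook_code d P =
     [num_diff_one_hooks P (d - b, b). b \<leftarrow> [0..<Suc d], (d - b, b) \<in> cells P]"


section \<open>The Jordan cell and its generic number of generators\<close>

definition jordan_cell :: "nat list \<Rightarrow> 'k::field poly2 set set" where
  "jordan_cell P = {I. graded_ideal I \<and> initial_ideal I = E_ideal P}"

text \<open>An ideal \<open>I\<close> of the cell is complementary to the span of the monomials of \<open>cells P\<close>, so a monomial
  \<open>m\<close> has a unique normal form modulo \<open>I\<close> supported there. The coefficients of these normal forms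
  determine \<open>I\<close>; they are its coordinates in the usual affine charts of the Grassmannians of the
  spaces \<open>R\<^sub>i\<close>, and they embed the cell in an affine space.\<close>

definition normal_form :: "nat list \<Rightarrow> 'k::field poly2 set \<Rightarrow> monomial \<Rightarrow> 'k poly2" where
  "normal_form P I m = (THE g. Poly_Mapping.keys g \<subseteq> cells P \<and> monom2 m - g \<in> I)"

definition coordinate :: "nat list \<Rightarrow> monomial \<Rightarrow> monomial \<Rightarrow> 'k::field poly2 set \<Rightarrow> 'k" where
  "coordinate P m n I = Poly_Mapping.lookup (normal_form P I m) n"

text \<open>The polynomial functions in the coordinates; their nonvanishing loci generate the Zariski
  topology on the set of \<open>k\<close>-points of the cell.\<close>

inductive_set coordinate_ring :: "nat list \<Rightarrow> ('k::field poly2 set \<Rightarrow> 'k) set" for P where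
  const: "(\<lambda>_. c) \<in> coordinate_ring P"
| coord: "coordinate P m n \<in> coordinate_ring P"
| add: "F \<in> coordinate_ring P \<Longrightarrow> G \<in> coordinate_ring P \<Longrightarrow> (\<lambda>I. F I + G I) \<in> coordinate_ring P"
| mult: "F \<in> coordinate_ring P \<Longrightarrow> G \<in> coordinate_ring P \<Longrightarrow> (\<lambda>I. F I * G I) \<in> coordinate_ring P"

definition zariski :: "nat list \<Rightarrow> 'k::field poly2 set topology" where
  "zariski P =
     topology_generated_by ((\<lambda>F. {I \<in> jordan_cell P. F I \<noteq> 0}) ` coordinate_ring P)"

definition generically :: "nat list \<Rightarrow> ('k::field poly2 set \<Rightarrow> bool) \<Rightarrow> bool" where
  "generically P Q \<longleftrightarrow>
     (\<exists>U. openin (zariski P) U \<and> U \<noteq> {} \<and> zariski P closure_of U = topspace (zariski P) \<and>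
          (\<forall>I \<in> U. Q I))"

definition kappa :: "'k::field itself \<Rightarrow> nat list \<Rightarrow> nat" where
  "kappa _ P = (THE n. generically P (\<lambda>I :: 'k poly2 set. num_gens I = n))"

lemma topspace_zariski: "topspace (zariski P :: 'k::field poly2 set topology) = jordan_cell P"
proof -
  let ?D = "\<lambda>F :: 'k poly2 set \<Rightarrow> 'k. {I \<in> jordan_cell P. F I \<noteq> 0}"
  have "?D (\<lambda>_. 1) \<in> ?D ` coordinate_ring P"
    by (rule imageI) (rule coordinate_ring.const)
  then have "jordan_cell P \<subseteq> \<Union> (?D ` coordinate_ring P)"
    by (intro Union_upper) simp
  moreover have "\<Union> (?D ` coordinate_ring P) \<subseteq> jordan_cell P" by blast
  ultimately show ?thesis
    unfolding zariski_def topology_generated_by_topspace by (rule equalityI[rotated])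
qed

lemma generically_unique:
  assumes "generically P (\<lambda>I. f I = m)" "generically P (\<lambda>I. f I = n)"
  shows "m = n"
proof -
  obtain U where U: "openin (zariski P) U" "U \<noteq> {}" "\<forall>I\<in>U. f I = m"
    using assms(1) unfolding generically_def by (elim exE conjE)
  obtain V where V: "zariski P closure_of V = topspace (zariski P)" "\<forall>I\<in>V. f I = n"
    using assms(2) unfolding generically_def by (elim exE conjE)
  from U(2) obtain I where I: "I \<in> U" by (meson ex_in_conv)
  then have "I \<in> topspace (zariski P)"
    using openin_subset[OF U(1)] by (rule subsetD[rotated])
  then have "I \<in> zariski P closure_of V" by (simp only: V(1))
  then obtain J where J: "J \<in> V" "J \<in> U"
    using U(1) I unfolding in_closure_of by meson
  have "f J = m" "f J = n"
    using bspec[OF U(3) J(2)] bspec[OF V(2) J(1)] .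
  then show ?thesis by (rule trans[OF sym])
qed

lemma kappa_eqI:
  assumes "generically P (\<lambda>I :: 'k::field poly2 set. num_gens I = n)"
  shows "kappa TYPE('k) P = n"
  unfolding kappa_def
proof (rule the_equality)
  show "generically P (\<lambda>I :: 'k poly2 set. num_gens I = n)" by (rule assms)
  show "m = n" if "generically P (\<lambda>I :: 'k poly2 set. num_gens I = m)" for m
    using that assms by (rule generically_unique)
qed

end

theory Submission
  imports Defs "HOL-Computational_Algebra.Polynomial"
begin

text \<open>Let \<open>R\<^sub>i\<close> be the space of forms of degree \<open>i\<close>. An ideal with Hilbert function \<open>T\<close> has no
  nonzero form of degree below \<open>d\<close> and contains all forms of degree above \<open>d\<close>. So it is determined by
  the \<open>s\<close>-dimensional space \<open>V\<close> of its forms of degree \<open>d\<close>, and a minimal system of generators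
  consists of a basis of \<open>V\<close> and of forms that complete \<open>xV + yV\<close> to \<open>R\<^bsub>d+1\<^esub>\<close>: their number is \<open>s\<close>
  plus the codimension of \<open>xV + yV\<close> in \<open>R\<^bsub>d+1\<^esub>\<close>. Let \<open>S\<close> be the set of the \<open>b \<le> d\<close> with
  \<open>x\<^bsup>d-b\<^esup>y\<^bsup>b\<^esup>\<close> in \<open>E\<^sub>P\<close>. The ideal lies in the Jordan cell of \<open>P\<close> if and only if \<open>V\<close> has a reduced
  echelon basis of forms \<open>f\<^sub>b\<close>, \<open>b \<in> S\<close>, where \<open>f\<^sub>b\<close> is \<open>x\<^bsup>d-b\<^esup>y\<^bsup>b\<^esup>\<close> plus a combination of monomials
  \<open>x\<^bsup>d-a\<^esup>y\<^bsup>a\<^esup>\<close> with \<open>a < b\<close>, \<open>a \<notin> S\<close> (lemmas \<open>cell_ideal_in_cell\<close>, \<open>jordan_cell_cases\<close>). The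
  coefficients are arbitrary, so the cell is an affine space, and the claim concerns the generic
  codimension of \<open>xV + yV\<close>.

  Write \<open>excess(\<gamma>)\<close> for the number of elements of \<open>{\<gamma>..d}\<close> outside \<open>S\<close> minus the number of those in
  \<open>S\<close>. For \<open>b < \<gamma>\<close> the products \<open>xf\<^sub>b\<close> and \<open>yf\<^sub>b\<close> lie in the span of the \<open>\<gamma> + 1\<close> monomials of degree
  \<open>d + 1\<close> and \<open>y\<close>-degree at most \<open>\<gamma>\<close>; together with the remaining products this bounds the dimension
  of \<open>xV + yV\<close>, and the codimension is at least \<open>excess(\<gamma>)\<close>. As there are only \<open>2s\<close> products it is also
  at least \<open>d + 2 - 2s = excess(0) + 1 = t + 1 - s\<close> (lemma \<open>generators_ge\<close>).

  The main point is that these bounds are attained together (lemma \<open>spread_family\<close>). With \<open>x = 1\<close> the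
  forms become polynomials in \<open>y\<close>, and \<open>V\<close> is built from the top degree downwards. When a new degree
  \<open>\<beta> \<notin> S\<close> becomes available and \<open>excess(\<beta>)\<close> stays below the maximum over the larger degrees, there is
  a relation \<open>v + yw = 0\<close> with \<open>v, w \<in> V\<close>. Adding to every \<open>f\<^sub>b\<close> the multiple \<open>c(f\<^sub>b)y\<^bsup>\<beta>\<^esup>\<close>, for a linear
  functional \<open>c\<close> with \<open>c(w) = 0\<close> and \<open>c(v) \<noteq> 0\<close>, turns this relation into the missing element \<open>y\<^bsup>\<beta>\<^esup>\<close>.

  One ideal of maximal rank suffices: linear independence persists on the nonvanishing locus of a
  function in the coordinate ring (lemma \<open>indep_family_generic\<close>), and such a locus is dense, because
  functions in the coordinate ring restrict to polynomials on the lines of the cell and \<open>k\<close> is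
  infinite (lemma \<open>generically_basic\<close>).

  Finally, the number of difference-one hooks with hand \<open>x\<^bsup>d-b\<^esup>y\<^bsup>b\<^esup>\<close> is the number of elements of \<open>S\<close>
  above \<open>b\<close> (lemma \<open>num_diff_one_hooks_eq\<close>). So \<open>\<tau>\<^sub>k\<close> is the value of \<open>excess\<close> at the first hand of the
  \<open>k\<close>-th block of the hook code, and no value of \<open>excess\<close> exceeds the largest of \<open>0\<close> and the
  \<open>\<tau>\<^sub>k\<close> (lemma \<open>max_excess_eq\<close>).\<close>

section \<open>Independent families of vectors\<close>

definition (in vector_space) indep_family :: "'i set \<Rightarrow> ('i \<Rightarrow> 'b) \<Rightarrow> bool" where
  "indep_family K v \<longleftrightarrow> (\<forall>a. (\<Sum>i\<in>K. scale (a i) (v i)) = 0 \<longrightarrow> (\<forall>i\<in>K. a i = 0))"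

lemma (in vector_space) indep_family_inj_on:
  assumes "finite K" "indep_family K v"
  shows "inj_on v K"
proof (rule inj_onI, rule ccontr)
  fix i j assume ij: "i \<in> K" "j \<in> K" "v i = v j" "i \<noteq> j"
  define a where "a = (\<lambda>k. if k = i then 1 else if k = j then -1 else (0::'a))"
  have "(\<Sum>k\<in>K. scale (a k) (v k)) = (\<Sum>k\<in>{i, j}. scale (a k) (v k))"
    by (rule sum.mono_neutral_right) (use assms ij in \<open>auto simp: a_def\<close>)
  also have "\<dots> = 0" using ij by (simp add: a_def)
  finally have "a i = 0" using assms ij unfolding indep_family_def by blast
  then show False by (simp add: a_def)
qed

lemma (in vector_space) indep_family_independent:
  assumes "finite K" "indep_family K v"
  shows "independent (v ` K)"
proof (rule independent_if_scalars_zero)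
  fix f x assume f: "(\<Sum>x\<in>v ` K. scale (f x) x) = 0" and x: "x \<in> v ` K"
  have "(\<Sum>i\<in>K. scale (f (v i)) (v i)) = 0"
    using f by (simp add: sum.reindex[OF indep_family_inj_on[OF assms]])
  then have "\<forall>i\<in>K. f (v i) = 0"
    using assms(2)[unfolded indep_family_def, THEN spec, of "\<lambda>i. f (v i)"] by blast
  then show "f x = 0" using x by blast
qed (use assms in simp)

lemma (in vector_space) indep_family_card_le:
  assumes "finite K" "finite B" "indep_family K v" "v ` K \<subseteq> span B"
  shows "card K \<le> card B"
  using independent_span_bound[OF assms(2) indep_family_independent[OF assms(1,3)] assms(4)]
    card_image[OF indep_family_inj_on[OF assms(1,3)]] by simp

text \<open>Gaussian elimination over the algebra \<open>A\<close> of functions, without denominators, so that the entries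
  stay in \<open>A\<close>. The function \<open>F\<close> is the product of the pivots met on the way; it plays the role
  of a nonvanishing minor.\<close>

lemma indep_family_generic:
  fixes A :: "('x \<Rightarrow> 'k::field) set" and M :: "'i \<Rightarrow> 'n \<Rightarrow> 'x \<Rightarrow> 'k"
  assumes const: "\<And>c. (\<lambda>_. c) \<in> A"
    and add: "\<And>F G. F \<in> A \<Longrightarrow> G \<in> A \<Longrightarrow> (\<lambda>x. F x + G x) \<in> A"
    and mult: "\<And>F G. F \<in> A \<Longrightarrow> G \<in> A \<Longrightarrow> (\<lambda>x. F x * G x) \<in> A"
    and "finite K" "\<And>i n. i \<in> K \<Longrightarrow> M i n \<in> A"
    and "\<And>a. (\<And>n. (\<Sum>i\<in>K. a i * M i n p) = 0) \<Longrightarrow> \<forall>i\<in>K. a i = 0"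
  shows "\<exists>F\<in>A. F p \<noteq> 0 \<and> (\<forall>x. F x \<noteq> 0 \<longrightarrow> (\<forall>a. (\<forall>n. (\<Sum>i\<in>K. a i * M i n x) = 0) \<longrightarrow> (\<forall>i\<in>K. a i = 0)))"
  using assms(4-6)
proof (induction K arbitrary: M rule: finite_induct)
  case empty
  then show ?case by (intro bexI[OF _ const[of 1]]) auto
next
  case (insert k K)
  have "\<exists>n. M k n p \<noteq> 0"
  proof (rule ccontr)
    assume "\<nexists>n. M k n p \<noteq> 0"
    then have "(\<Sum>i\<in>insert k K. (if i = k then 1 else 0) * M i n p) = 0" for n
      by (intro sum.neutral) auto
    from insert.prems(2)[OF this] show False by simp
  qed
  then obtain m where m: "M k m p \<noteq> 0" by blast
  \<comment> \<open>The column \<open>m\<close> is cleared with the pivot \<open>M k m\<close>.\<close>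
  define M' where "M' i n = (\<lambda>x. M k m x * M i n x + (-1) * (M i m x * M k n x))" for i n
  have comb: "(\<Sum>i\<in>K. a i * M' i n x) = M k m x * (\<Sum>i\<in>K. a i * M i n x) - (\<Sum>i\<in>K. a i * M i m x) * M k n x" for a n x
    by (simp add: M'_def algebra_simps sum_subtractf sum_distrib_left)
  have M'A: "M' i n \<in> A" if "i \<in> K" for i n
    unfolding M'_def using that by (intro add mult const insert.prems(1)) auto
  have indp: "\<forall>i\<in>K. a i = 0" if a: "\<And>n. (\<Sum>i\<in>K. a i * M' i n p) = 0" for a
  proof -
    define b where "b i = (if i = k then - (\<Sum>i\<in>K. a i * M i m p) else a i * M k m p)" for i
    have "(\<Sum>i\<in>insert k K. b i * M i n p) = 0" for n
    proof -
      have "(\<Sum>i\<in>K. b i * M i n p) = M k m p * (\<Sum>i\<in>K. a i * M i n p)"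
        unfolding sum_distrib_left by (rule sum.cong) (use insert.hyps in \<open>auto simp: b_def\<close>)
      then have "(\<Sum>i\<in>insert k K. b i * M i n p) = (\<Sum>i\<in>K. a i * M' i n p)"
        using insert.hyps by (simp add: comb b_def)
      then show ?thesis using a by simp
    qed
    from insert.prems(2)[OF this] have "\<forall>i\<in>K. b i = 0" by blast
    moreover have "b i = a i * M k m p" if "i \<in> K" for i using insert.hyps that by (auto simp: b_def)
    ultimately show ?thesis using m by simp
  qed
  obtain F where F: "F \<in> A" "F p \<noteq> 0"
    "\<And>x a. F x \<noteq> 0 \<Longrightarrow> (\<And>n. (\<Sum>i\<in>K. a i * M' i n x) = 0) \<Longrightarrow> (\<forall>i\<in>K. a i = 0)"
    using insert.IH[of M', OF M'A indp] by blast
  have "\<forall>i\<in>insert k K. a i = 0"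
    if x: "F x * M k m x \<noteq> 0" and a: "\<And>n. (\<Sum>i\<in>insert k K. a i * M i n x) = 0" for x a
  proof -
    have s: "(\<Sum>i\<in>K. a i * M i n x) = - (a k * M k n x)" for n
      using a[of n] insert.hyps by (simp add: add.commute eq_neg_iff_add_eq_0)
    have "(\<Sum>i\<in>K. a i * M' i n x) = 0" for n
      unfolding comb s by simp
    with F(3)[of x a] x have K: "\<forall>i\<in>K. a i = 0" by simp
    then have "a k * M k m x = 0" using s[of m] by simp
    with x K show ?thesis by simp
  qed
  then show ?case
    using F m insert.prems(1)[of k m] by (intro bexI[of _ "\<lambda>x. F x * M k m x"] mult) auto
qed

section \<open>Echelon families of polynomials and multiplication by the variable\<close>

interpretation poly1: vector_space "smult :: 'k::field \<Rightarrow> 'k poly \<Rightarrow> 'k poly"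
  by unfold_locales (simp_all add: smult_add_right smult_add_left)

interpretation poly1_field: vector_space_pair "smult :: 'k::field \<Rightarrow> 'k poly \<Rightarrow> 'k poly" "(*) :: 'k \<Rightarrow> 'k \<Rightarrow> 'k"
  by unfold_locales (simp_all add: algebra_simps)

lemma poly_in_span_monom:
  fixes p :: "'k::field poly"
  assumes "\<And>i. coeff p i \<noteq> 0 \<Longrightarrow> i \<in> N"
  shows "p \<in> poly1.span (monom 1 ` N)"
proof -
  have "p = (\<Sum>i\<le>degree p. smult (coeff p i) (monom 1 i))"
    by (simp add: smult_monom poly_as_sum_of_monoms)
  moreover have "smult (coeff p i) (monom 1 i) \<in> poly1.span (monom 1 ` N)" for i
    using assms[of i] by (cases "coeff p i = 0") (auto intro: poly1.span_scale poly1.span_base poly1.span_zero)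
  ultimately show ?thesis by (metis (no_types, lifting) poly1.span_sum)
qed

text \<open>The members of a reduced echelon basis: leading term \<open>y\<^bsup>b\<^esup>\<close>, and all other terms in degrees
  from \<open>\<beta>\<close> on that are not leading degrees (the set \<open>S\<close>) themselves.\<close>

definition monic_mod :: "nat set \<Rightarrow> nat \<Rightarrow> nat \<Rightarrow> 'k::field poly \<Rightarrow> bool" where
  "monic_mod S \<beta> b p \<longleftrightarrow> coeff p b = 1 \<and> (\<forall>i. i \<noteq> b \<longrightarrow> coeff p i \<noteq> 0 \<longrightarrow> \<beta> \<le> i \<and> i < b \<and> i \<notin> S)"

text \<open>For \<open>V\<close> spanned by \<open>f ` B\<close>, this set spans \<open>V + yV\<close>, the dehomogenization of \<open>xV + yV\<close>.\<close>

definition with_shift :: "(nat \<Rightarrow> 'k::field poly) \<Rightarrow> nat set \<Rightarrow> 'k poly set" where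
  "with_shift f B = f ` B \<union> (\<lambda>b. pCons 0 (f b)) ` B"

definition excess :: "nat set \<Rightarrow> nat \<Rightarrow> nat \<Rightarrow> int" where
  "excess S d \<gamma> = int (card ({\<gamma>..d} - S)) - int (card ({\<gamma>..d} \<inter> S))"

text \<open>The index \<open>Suc d\<close>, where \<open>excess\<close> vanishes, is included: this makes \<open>peak\<close> nonnegative.\<close>

definition peak :: "nat set \<Rightarrow> nat \<Rightarrow> nat \<Rightarrow> int" where
  "peak S d \<beta> = Max (excess S d ` {\<beta>..Suc d})"

lemma excess_top [simp]: "excess S d (Suc d) = 0"
  by (simp add: excess_def)

lemma excess_step:
  assumes "\<beta> \<le> d"
  shows "excess S d \<beta> = excess S d (Suc \<beta>) + (if \<beta> \<in> S then -1 else 1)"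
proof -
  have *: "{\<beta>..d} = insert \<beta> {Suc \<beta>..d}" using assms by auto
  show ?thesis unfolding excess_def * by (auto simp: insert_Diff_if)
qed

lemma peak_step:
  assumes "\<beta> \<le> d"
  shows "peak S d \<beta> = max (excess S d \<beta>) (peak S d (Suc \<beta>))"
proof -
  have *: "{\<beta>..Suc d} = insert \<beta> {Suc \<beta>..Suc d}" using assms by auto
  show ?thesis unfolding peak_def * by (subst image_insert, subst Max_insert) (use assms in auto)
qed

lemma excess_le_peak: "\<beta> \<le> \<gamma> \<Longrightarrow> \<gamma> \<le> Suc d \<Longrightarrow> excess S d \<gamma> \<le> peak S d \<beta>"
  unfolding peak_def by (intro Max_ge) auto

lemma peak_attained:
  assumes "\<beta> \<le> Suc d"
  obtains \<gamma> where "\<beta> \<le> \<gamma>" "\<gamma> \<le> Suc d" "excess S d \<gamma> = peak S d \<beta>"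
proof -
  have "peak S d \<beta> \<in> excess S d ` {\<beta>..Suc d}"
    unfolding peak_def using assms by (intro Max_in) auto
  then show ?thesis using that by auto
qed

lemma excess_diff:
  assumes "\<beta> \<le> \<gamma>" "\<gamma> \<le> Suc d"
  shows "excess S d \<gamma> - excess S d \<beta> = 2 * int (card ({\<beta>..<\<gamma>} \<inter> S)) - int (\<gamma> - \<beta>)"
  using assms
proof (induction rule: dec_induct)
  case (step n)
  have *: "{\<beta>..<Suc n} = insert n {\<beta>..<n}" using step by auto
  show ?case using step excess_step[of n d S]
    unfolding * by (auto simp: of_nat_diff Int_insert_left)
qed simp

text \<open>Polynomials with distinct leading degrees are independent: look at the largest degree involved.\<close>

lemma monic_sum_zeroD:
  fixes f :: "nat \<Rightarrow> 'k::field poly"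
  assumes "finite B" "\<And>b. b \<in> B \<Longrightarrow> monic_mod S \<beta> b (f b)"
    and "(\<Sum>b\<in>B. smult (a b) (f b)) = 0" "b \<in> B"
  shows "a b = 0"
proof (rule ccontr)
  assume "a b \<noteq> 0"
  define m where "m = Max {b\<in>B. a b \<noteq> 0}"
  have ne: "{b\<in>B. a b \<noteq> 0} \<noteq> {}" using assms(4) \<open>a b \<noteq> 0\<close> by auto
  then have m: "m \<in> B" "a m \<noteq> 0" using Max_in[OF _ ne] assms(1) unfolding m_def by auto
  have mx: "b \<le> m" if "b \<in> B" "a b \<noteq> 0" for b
    using that assms(1) unfolding m_def by (intro Max_ge) auto
  have "0 = (\<Sum>b\<in>B. a b * coeff (f b) m)"
    using arg_cong[OF assms(3), of "\<lambda>p. coeff p m"] by (simp add: coeff_sum)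
  also have "\<dots> = (\<Sum>b\<in>{m}. a b * coeff (f b) m)"
  proof (rule sum.mono_neutral_right)
    show "\<forall>i\<in>B - {m}. a i * coeff (f i) m = 0"
      using mx assms(2) unfolding monic_mod_def by (metis Diff_iff leD mult_eq_0_iff singletonI)
  qed (use m assms(1) in auto)
  also have "\<dots> = a m" using m assms(2)[of m] by (simp add: monic_mod_def)
  finally show False using m by simp
qed

text \<open>If \<open>m\<close> members of the family have degree below \<open>\<gamma>\<close>, then they and their multiples by \<open>y\<close> are \<open>2m\<close>
  vectors in the span of \<open>y\<^bsup>\<beta>\<^esup>, \<dots>, y\<^bsup>\<gamma>\<^esup>\<close>. When \<open>2m\<close> exceeds \<open>\<gamma> - \<beta> + 1\<close> they are
  dependent. The family itself is independent, so the multiples of \<open>y\<close> take part in the relation.\<close>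

lemma shift_relation:
  fixes f :: "nat \<Rightarrow> 'k::field poly"
  assumes f: "\<And>b. b \<in> {\<beta>..<\<gamma>} \<inter> S \<Longrightarrow> monic_mod S \<beta> b (f b)"
    and "\<beta> \<le> \<gamma>" and card: "Suc (\<gamma> - \<beta>) < 2 * card ({\<beta>..<\<gamma>} \<inter> S)"
  obtains v w where "v \<in> poly1.span (f ` ({\<beta>..<\<gamma>} \<inter> S))" "w \<in> poly1.span (f ` ({\<beta>..<\<gamma>} \<inter> S))"
    "v + pCons 0 w = 0" "w \<noteq> 0"
proof -
  let ?B = "{\<beta>..<\<gamma>} \<inter> S"
  define u where "u = case_sum f (\<lambda>b. pCons 0 (f b))"
  have in_span: "u ` (?B <+> ?B) \<subseteq> poly1.span (monom 1 ` {\<beta>..\<gamma>})"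
  proof clarify
    fix z assume "z \<in> ?B <+> ?B"
    then obtain b where b: "b \<in> ?B" "u z = f b \<or> u z = pCons 0 (f b)" by (auto simp: u_def)
    have co: "coeff (f b) i \<noteq> 0 \<Longrightarrow> \<beta> \<le> i \<and> i < \<gamma>" for i
      using f[OF b(1)] b(1) unfolding monic_mod_def by (cases "i = b") fastforce+
    show "u z \<in> poly1.span (monom 1 ` {\<beta>..\<gamma>})"
    proof (rule poly_in_span_monom)
      fix i assume "coeff (u z) i \<noteq> 0"
      with b(2) co[of i] co[of "i - 1"] show "i \<in> {\<beta>..\<gamma>}"
        by (auto simp: coeff_pCons split: nat.splits)
    qed
  qed
  have "card (monom (1::'k) ` {\<beta>..\<gamma>}) < card (?B <+> ?B)"
    using card_image_le[of "{\<beta>..\<gamma>}" "monom (1::'k)"] card assms(2) by (simp add: card_Plus)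
  then have "\<not> poly1.indep_family (?B <+> ?B) u"
    using poly1.indep_family_card_le[OF _ _ _ in_span] by fastforce
  then obtain a where a: "(\<Sum>z\<in>?B <+> ?B. smult (a z) (u z)) = 0" "\<exists>z\<in>?B <+> ?B. a z \<noteq> 0"
    unfolding poly1.indep_family_def by blast
  define v where "v = (\<Sum>b\<in>?B. smult (a (Inl b)) (f b))"
  define w where "w = (\<Sum>b\<in>?B. smult (a (Inr b)) (f b))"
  have "(\<Sum>b\<in>?B. smult (a (Inr b)) (pCons 0 (f b))) = pCons 0 w"
    unfolding w_def by (rule poly_eqI) (simp add: coeff_sum coeff_pCons split: nat.splits)
  then have rel: "v + pCons 0 w = 0"
    using a(1) by (simp add: sum.Plus u_def v_def)
  have "w \<noteq> 0"
  proof
    assume "w = 0"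
    with rel have "v = 0" by simp
    have "a (Inl b) = 0" if "b \<in> ?B" for b
      using monic_sum_zeroD[of ?B S \<beta> f "\<lambda>b. a (Inl b)"] f \<open>v = 0\<close> that unfolding v_def by blast
    moreover have "a (Inr b) = 0" if "b \<in> ?B" for b
      using monic_sum_zeroD[of ?B S \<beta> f "\<lambda>b. a (Inr b)"] f \<open>w = 0\<close> that unfolding w_def by blast
    ultimately show False using a(2) by auto
  qed
  moreover have "v \<in> poly1.span (f ` ?B)" "w \<in> poly1.span (f ` ?B)"
    unfolding v_def w_def
    by (rule poly1.span_sum, rule poly1.span_scale, rule poly1.span_base, rule imageI, assumption)+
  ultimately show ?thesis using that rel by blast
qed

text \<open>Since \<open>w \<noteq> 0\<close>, the polynomial \<open>v = -yw\<close> is not a scalar multiple of \<open>w\<close>, a functional can take independent values on \<open>v\<close> and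
  \<open>w\<close>; scaling it avoids the one value that is forbidden at \<open>q\<close>.\<close>

lemma functional_avoiding:
  fixes v w q :: "'k::field poly"
  assumes "infinite (UNIV :: 'k set)" "v + pCons 0 w = 0" "w \<noteq> 0"
  obtains c :: "'k poly \<Rightarrow> 'k" where "Vector_Spaces.linear smult (*) c" "c w = 0" "c v \<noteq> 0" "1 + c q \<noteq> 0"
proof -
  have v: "v = - pCons 0 w" using assms(2) by (rule eq_neg_iff_add_eq_0[THEN iffD2])
  have "v \<notin> poly1.span {w}"
  proof
    assume "v \<in> poly1.span {w}"
    then obtain k where "v = smult k w" by (auto simp: poly1.span_singleton)
    with v have "[:k, 1:] * w = 0" by (simp add: add_eq_0_iff)
    then show False using assms(3) by (metis mult_eq_0_iff pCons_eq_0_iff one_neq_zero)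
  qed
  then have ind: "poly1.independent {v, w}" and "v \<noteq> w"
    using assms(3) poly1.independent_insertI[of v "{w}"] by (auto intro: poly1.span_base)
  obtain c where c: "Vector_Spaces.linear smult (*) c" "\<forall>x\<in>{v, w}. c x = (if x = v then 1 else (0::'k))"
    using poly1_field.linear_independent_extend[OF ind, of "\<lambda>x. if x = v then 1 else (0::'k)"] by blast
  have "finite {0, - inverse (c q)}" by simp
  then obtain k where k: "k \<notin> {0, - inverse (c q)}"
    using assms(1) by (meson UNIV_I ex_new_if_finite)
  have "1 + k * c q \<noteq> 0"
  proof
    assume "1 + k * c q = 0"
    then have "k * c q = -1" by (simp add: add_eq_0_iff)
    then have "k = - inverse (c q)"
      by (metis inverse_unique minus_minus mult.commute mult_minus_left)
    then show False using k by simp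
  qed
  moreover have "Vector_Spaces.linear smult (*) (\<lambda>x. k * c x)"
    using c(1) unfolding Vector_Spaces.linear_iff by (simp add: algebra_simps)
  ultimately show ?thesis
    using that[of "\<lambda>x. k * c x"] c(2) k \<open>v \<noteq> w\<close> by simp
qed

lemma monic_mod_mono: "monic_mod S (Suc \<beta>) b p \<Longrightarrow> monic_mod S \<beta> b p"
  unfolding monic_mod_def by (metis Suc_leD)

text \<open>The induction needs more than the codimension of \<open>V + yV\<close>: besides, it has to be known what
  happens when the lowest power \<open>y\<^bsup>\<beta>\<^esup>\<close> is adjoined, because \<open>y\<^bsup>\<beta>\<^esup>\<close> becomes available for free if the next
  lower degree is in \<open>S\<close>. So the set \<open>A\<close> of powers completes \<open>V + yV\<close> and \<open>y\<^bsup>\<beta>\<^esup>\<close> to everything, and \<open>y\<^bsup>\<beta>\<^esup>\<close>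
  itself is in \<open>V + yV\<close> whenever the bound at \<open>\<beta>\<close> is not sharp.\<close>

lemma spread_family:
  assumes inf: "infinite (UNIV :: 'k::field set)" and "\<beta> \<le> Suc d"
  shows "\<exists>(f :: nat \<Rightarrow> 'k poly) A. (\<forall>b\<in>{\<beta>..d} \<inter> S. monic_mod S \<beta> b (f b)) \<and>
    A \<subseteq> {\<beta>..Suc d} \<and> int (card A) \<le> peak S d \<beta> \<and>
    (\<forall>i\<in>{\<beta>..Suc d}. monom 1 i \<in> poly1.span (with_shift f ({\<beta>..d} \<inter> S) \<union> monom 1 ` insert \<beta> A)) \<and>
    (excess S d \<beta> < peak S d \<beta> \<longrightarrow> monom 1 \<beta> \<in> poly1.span (with_shift f ({\<beta>..d} \<inter> S)))"
  using assms(2)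
proof (induction rule: inc_induct)
  case base
  show ?case
    by (rule exI[of _ "\<lambda>_. 0"], rule exI[of _ "{}"])
       (auto simp: peak_def with_shift_def intro!: poly1.span_base)
next
  case (step \<beta>)
  from step.hyps have "\<beta> \<le> d" by simp
  let ?B' = "{Suc \<beta>..d} \<inter> S" and ?B = "{\<beta>..d} \<inter> S"
  from step.IH obtain f :: "nat \<Rightarrow> 'k poly" and A where
    f: "\<And>b. b \<in> ?B' \<Longrightarrow> monic_mod S (Suc \<beta>) b (f b)" and
    A: "A \<subseteq> {Suc \<beta>..Suc d}" "int (card A) \<le> peak S d (Suc \<beta>)" and
    sp: "\<And>i. i \<in> {Suc \<beta>..Suc d} \<Longrightarrow> monom 1 i \<in> poly1.span (with_shift f ?B' \<union> monom 1 ` insert (Suc \<beta>) A)" and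
    low: "excess S d (Suc \<beta>) < peak S d (Suc \<beta>) \<Longrightarrow> monom 1 (Suc \<beta>) \<in> poly1.span (with_shift f ?B')"
    by blast
  have fin: "finite A" using A(1) finite_subset by blast
  note ex = excess_step[OF \<open>\<beta> \<le> d\<close>, of S] and pk = peak_step[OF \<open>\<beta> \<le> d\<close>, of S]
  have le: "excess S d (Suc \<beta>) \<le> peak S d (Suc \<beta>)" using \<open>\<beta> \<le> d\<close> by (intro excess_le_peak) auto
  show ?case
  proof (cases "\<beta> \<in> S")
    case True
    have B: "?B = insert \<beta> ?B'" using True \<open>\<beta> \<le> d\<close> by auto
    \<comment> \<open>The new member \<open>y\<^bsup>\<beta>\<^esup>\<close> contributes \<open>y\<^bsup>\<beta>\<^esup>\<close> and \<open>y\<^bsup>\<beta>+1\<^esup>\<close>, and \<open>y\<^bsup>\<beta>+1\<^esup>\<close> is just what was adjoined before.\<close>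
    let ?f = "f(\<beta> := monom 1 \<beta>)"
    have ws: "with_shift ?f ?B = with_shift f ?B' \<union> monom 1 ` {\<beta>, Suc \<beta>}"
      unfolding B by (auto simp: with_shift_def monom_Suc image_iff)
    have mono: "monic_mod S \<beta> b (?f b)" if "b \<in> ?B" for b
    proof (cases "b = \<beta>")
      case False
      then show ?thesis using that monic_mod_mono[OF f[of b]] B by simp
    qed (simp add: monic_mod_def)
    have "monom 1 i \<in> poly1.span (with_shift ?f ?B \<union> monom 1 ` insert \<beta> A)" if i: "i \<in> {\<beta>..Suc d}" for i
    proof (cases "i = \<beta>")
      case False
      then have "monom 1 i \<in> poly1.span (with_shift f ?B' \<union> monom 1 ` insert (Suc \<beta>) A)" using i sp by simp
      then show ?thesis
        by (rule subsetD[OF poly1.span_mono, rotated]) (auto simp: ws)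
    qed (auto intro: poly1.span_base)
    moreover have "monom 1 \<beta> \<in> poly1.span (with_shift ?f ?B)" by (auto simp: ws intro: poly1.span_base)
    moreover have "int (card A) \<le> peak S d \<beta>" "A \<subseteq> {\<beta>..Suc d}"
      using A by (auto simp: pk)
    ultimately show ?thesis using mono by blast
  next
    case False
    then have B: "?B = ?B'" by (auto simp: le_eq_less_or_eq Suc_le_eq)
    have mono: "\<And>b. b \<in> ?B \<Longrightarrow> monic_mod S \<beta> b (f b)" using f monic_mod_mono unfolding B by blast
    consider (top) "excess S d (Suc \<beta>) = peak S d (Suc \<beta>)"
      | (eq) "excess S d (Suc \<beta>) < peak S d (Suc \<beta>)" "excess S d \<beta> = peak S d \<beta>"
      | (less) "excess S d \<beta> < peak S d \<beta>"
      using le excess_le_peak[of \<beta> \<beta> d S] step.hyps by fastforce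
    then show ?thesis
    proof cases
      case top
      \<comment> \<open>The bound grows by one, which leaves room for \<open>y\<^bsup>\<beta>+1\<^esup>\<close> in the complement.\<close>
      let ?A = "insert (Suc \<beta>) A"
      have "excess S d \<beta> = peak S d \<beta>" using top False unfolding ex pk by simp
      moreover have "int (card ?A) \<le> peak S d \<beta>"
        using card_insert_le_m1[of _ A] A(2) top False fin unfolding ex pk
        by (auto simp: card_insert_if)
      moreover have "monom 1 i \<in> poly1.span (with_shift f ?B \<union> monom 1 ` insert \<beta> ?A)" if i: "i \<in> {\<beta>..Suc d}" for i
      proof (cases "i = \<beta>")
        case False
        then have "monom 1 i \<in> poly1.span (with_shift f ?B' \<union> monom 1 ` insert (Suc \<beta>) A)" using i sp by simp
        then show ?thesis
          by (rule subsetD[OF poly1.span_mono, rotated]) (auto simp: B)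
      qed (auto intro: poly1.span_base)
      moreover have "?A \<subseteq> {\<beta>..Suc d}" using A(1) \<open>\<beta> \<le> d\<close> by auto
      ultimately show ?thesis using mono by (intro exI[of _ f] exI[of _ ?A]) simp
    next
      case eq
      \<comment> \<open>Nothing changes: \<open>y\<^bsup>\<beta>+1\<^esup>\<close> was in \<open>V + yV\<close> already, and \<open>y\<^bsup>\<beta>\<^esup>\<close> need not
        be, as \<open>excess\<close> is maximal at \<open>\<beta>\<close>.\<close>
      have "monom 1 i \<in> poly1.span (with_shift f ?B \<union> monom 1 ` insert \<beta> A)" if i: "i \<in> {\<beta>..Suc d}" for i
      proof (cases "i = \<beta>")
        case False
        then have "monom 1 i \<in> poly1.span (with_shift f ?B' \<union> monom 1 ` insert (Suc \<beta>) A)" using i sp by simp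
        also have "\<dots> \<subseteq> poly1.span (with_shift f ?B \<union> monom 1 ` insert \<beta> A)"
          using low[OF eq(1)] poly1.span_mono[of "with_shift f ?B'" "with_shift f ?B \<union> monom 1 ` insert \<beta> A"]
          by (intro poly1.span_minimal poly1.subspace_span) (auto simp: B intro: poly1.span_base)
        finally show ?thesis .
      qed (auto intro: poly1.span_base)
      moreover have "int (card A) \<le> peak S d \<beta>" "A \<subseteq> {\<beta>..Suc d}" using A by (auto simp: pk)
      ultimately show ?thesis using mono eq(2) by (intro exI[of _ f] exI[of _ A]) simp
    next
      case less
      then have less': "excess S d \<beta> < peak S d (Suc \<beta>)" unfolding pk by simp
      then have lt: "excess S d (Suc \<beta>) < peak S d (Suc \<beta>)" using ex False by simp
      \<comment> \<open>Between \<open>\<beta> + 1\<close> and the place \<open>\<gamma>\<close> of the maximum, \<open>excess\<close> grows by at least 2, so \<open>S\<close> has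
        enough elements there for a relation.\<close>
      obtain \<gamma> where \<gamma>: "Suc \<beta> \<le> \<gamma>" "\<gamma> \<le> Suc d" "excess S d \<gamma> = peak S d (Suc \<beta>)"
        using peak_attained[of "Suc \<beta>" d S] \<open>\<beta> \<le> d\<close> by auto
      have sub: "{Suc \<beta>..<\<gamma>} \<inter> S \<subseteq> ?B'" using \<gamma> by auto
      have card: "Suc (\<gamma> - Suc \<beta>) < 2 * card ({Suc \<beta>..<\<gamma>} \<inter> S)"
        using excess_diff[OF \<gamma>(1,2), of S] less' \<gamma>(3) ex False by simp
      have "\<exists>v w. v \<in> poly1.span (f ` ({Suc \<beta>..<\<gamma>} \<inter> S)) \<and> w \<in> poly1.span (f ` ({Suc \<beta>..<\<gamma>} \<inter> S)) \<and>
          v + pCons 0 w = 0 \<and> w \<noteq> 0"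
        by (rule shift_relation[of "Suc \<beta>" \<gamma> S f]) (use f sub \<gamma>(1) card in blast)+
      then obtain v w where vw: "v \<in> poly1.span (f ` ?B')" "w \<in> poly1.span (f ` ?B')"
          "v + pCons 0 w = 0" "w \<noteq> 0"
        using poly1.span_mono[OF image_mono[OF sub, of f]] by blast
      have lin_shift: "Vector_Spaces.linear smult smult (pCons (0::'k))"
        unfolding Vector_Spaces.linear_iff by (simp add: poly1.vector_space_axioms)
      have "poly1.span ((\<lambda>b. pCons 0 (f b)) ` ?B') = pCons 0 ` poly1.span (f ` ?B')"
        using module_hom.span_image[OF lin_shift[THEN Vector_Spaces.linear.axioms(3)], of "f ` ?B'"]
        by (simp add: image_image)
      with low[OF lt] obtain p q where pq: "p \<in> poly1.span (f ` ?B')" "q \<in> poly1.span (f ` ?B')"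
          "monom 1 (Suc \<beta>) = p + pCons 0 q"
        unfolding with_shift_def poly1.span_Un by auto
      obtain c :: "'k poly \<Rightarrow> 'k" where c: "Vector_Spaces.linear smult (*) c" "c w = 0" "c v \<noteq> 0" "1 + c q \<noteq> 0"
        using functional_avoiding[OF inf vw(3,4)] .
      \<comment> \<open>The new family is the image of the old one under \<open>\<phi>\<close>. It produces \<open>y\<^bsup>\<beta>\<^esup>\<close> from the relation, then
        \<open>y\<^bsup>\<beta>+1\<^esup>\<close> from \<open>p + yq\<close>, and with these two powers it recovers the old \<open>V + yV\<close>.\<close>
      define \<phi> where "\<phi> u = u + monom (c u) \<beta>" for u
      let ?f = "\<lambda>b. \<phi> (f b)"
      let ?W = "poly1.span (with_shift ?f ?B)"
      have lin_\<phi>: "Vector_Spaces.linear smult smult \<phi>"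
        using c(1) unfolding Vector_Spaces.linear_iff \<phi>_def
        by (auto simp: poly1.vector_space_axioms add_monom[symmetric] smult_monom smult_add_right)
      have img: "\<phi> ` poly1.span (f ` ?B') = poly1.span (?f ` ?B)"
        using module_hom.span_image[OF lin_\<phi>[THEN Vector_Spaces.linear.axioms(3)], of "f ` ?B'"]
        by (simp add: image_image B)
      have W1: "\<phi> u \<in> ?W" if "u \<in> poly1.span (f ` ?B')" for u
        using img that poly1.span_mono[of "?f ` ?B" "with_shift ?f ?B"] by (auto simp: with_shift_def)
      have W2: "pCons 0 (\<phi> u) \<in> ?W" if "u \<in> poly1.span (f ` ?B')" for u
      proof -
        have "pCons 0 (\<phi> u) \<in> poly1.span (pCons 0 ` ?f ` ?B)"
          using img that module_hom.span_image[OF lin_shift[THEN Vector_Spaces.linear.axioms(3)], of "?f ` ?B"]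
          by auto
        then show ?thesis
          by (rule subsetD[OF poly1.span_mono, rotated]) (auto simp: with_shift_def)
      qed
      have scaled: "x \<in> ?W" if "smult k x \<in> ?W" "k \<noteq> 0" for k x
        using poly1.span_scale[OF that(1), of "inverse k"] that(2) by simp
      have "\<phi> v + pCons 0 (\<phi> w) = smult (c v) (monom 1 \<beta>)"
        using vw(3) c(2) by (simp add: \<phi>_def smult_monom algebra_simps)
      then have m0: "monom 1 \<beta> \<in> ?W"
        using scaled[OF _ c(3)] poly1.span_add[OF W1[OF vw(1)] W2[OF vw(2)]] by metis
      have "\<phi> p + pCons 0 (\<phi> q) - smult (c p) (monom 1 \<beta>) = (p + pCons 0 q) + smult (c q) (monom 1 (Suc \<beta>))"
        by (simp add: \<phi>_def smult_monom monom_Suc algebra_simps)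
      also have "\<dots> = smult (1 + c q) (monom 1 (Suc \<beta>))"
        unfolding pq(3)[symmetric] by (simp add: smult_add_left)
      finally have m1: "monom 1 (Suc \<beta>) \<in> ?W"
        using scaled[OF _ c(4)] poly1.span_diff[OF poly1.span_add[OF W1[OF pq(1)] W2[OF pq(2)]] poly1.span_scale[OF m0, of "c p"]]
        by metis
      have old: "with_shift f ?B' \<subseteq> ?W"
      proof -
        have "f b \<in> ?W" "pCons 0 (f b) \<in> ?W" if "b \<in> ?B'" for b
        proof -
          have b: "f b \<in> poly1.span (f ` ?B')" using that by (auto intro: poly1.span_base)
          have "f b = \<phi> (f b) - smult (c (f b)) (monom 1 \<beta>)" by (simp add: \<phi>_def smult_monom)
          then show "f b \<in> ?W"
            using poly1.span_diff[OF W1[OF b] poly1.span_scale[OF m0]] by metis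
          have "pCons 0 (f b) = pCons 0 (\<phi> (f b)) - smult (c (f b)) (monom 1 (Suc \<beta>))"
            by (simp add: \<phi>_def smult_monom monom_Suc)
          then show "pCons 0 (f b) \<in> ?W"
            using poly1.span_diff[OF W2[OF b] poly1.span_scale[OF m1]] by metis
        qed
        then show ?thesis by (auto simp: with_shift_def)
      qed
      have "monom 1 i \<in> poly1.span (with_shift ?f ?B \<union> monom 1 ` insert \<beta> A)" if i: "i \<in> {\<beta>..Suc d}" for i
      proof (cases "i = \<beta>")
        case False
        then have "monom 1 i \<in> poly1.span (with_shift f ?B' \<union> monom 1 ` insert (Suc \<beta>) A)" using i sp by simp
        also have "\<dots> \<subseteq> poly1.span (with_shift ?f ?B \<union> monom 1 ` insert \<beta> A)"
          using old m1 poly1.span_mono[of "with_shift ?f ?B" "with_shift ?f ?B \<union> monom 1 ` insert \<beta> A"]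
          by (intro poly1.span_minimal poly1.subspace_span) (auto intro: poly1.span_base)
        finally show ?thesis .
      qed (auto intro: poly1.span_base)
      moreover have "monic_mod S \<beta> b (?f b)" if "b \<in> ?B" for b
      proof -
        have "b \<in> ?B'" using that B by simp
        then show ?thesis using f[of b] False
          by (auto simp: monic_mod_def \<phi>_def Suc_le_eq split: if_splits)
      qed
      moreover have "int (card A) \<le> peak S d \<beta>" "A \<subseteq> {\<beta>..Suc d}" using A by (auto simp: pk)
      ultimately show ?thesis using m0 by (intro exI[of _ ?f] exI[of _ A]) simp
    qed
  qed
qed

section \<open>Monomials, forms and initial monomials\<close>

abbreviation deg :: "monomial \<Rightarrow> nat" where "deg m \<equiv> fst m + snd m"

lemma lookup_scale2 [simp]: "Poly_Mapping.lookup (scale2 c f) m = c * Poly_Mapping.lookup f m"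
  by (simp add: scale2_def map.rep_eq when_def flip: mult_map_scale_conv_mult)

lemma poly_mapping_sum_single: "(\<Sum>m\<in>Poly_Mapping.keys f. Poly_Mapping.single m (Poly_Mapping.lookup f m)) = f"
proof (rule poly_mapping_eqI)
  fix k
  have "(\<Sum>m\<in>Poly_Mapping.keys f. Poly_Mapping.lookup (Poly_Mapping.single m (Poly_Mapping.lookup f m)) k) =
      (\<Sum>m\<in>Poly_Mapping.keys f. if m = k then Poly_Mapping.lookup f m else 0)"
    by (rule sum.cong) (auto simp: lookup_single when_def)
  then show "Poly_Mapping.lookup (\<Sum>m\<in>Poly_Mapping.keys f. Poly_Mapping.single m (Poly_Mapping.lookup f m)) k = Poly_Mapping.lookup f k"
    by (simp add: lookup_sum sum.delta in_keys_iff)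
qed

lemma lookup_single_mult:
  fixes f :: "'k::field poly2"
  shows "Poly_Mapping.lookup (Poly_Mapping.single k c * f) m =
    (if fst k \<le> fst m \<and> snd k \<le> snd m then c * Poly_Mapping.lookup f (fst m - fst k, snd m - snd k) else 0)"
proof -
  have "Poly_Mapping.single k c * f =
      (\<Sum>n\<in>Poly_Mapping.keys f. Poly_Mapping.single (k + n) (c * Poly_Mapping.lookup f n))"
    by (subst (1) poly_mapping_sum_single[of f, symmetric]) (simp add: sum_distrib_left mult_single)
  then have "Poly_Mapping.lookup (Poly_Mapping.single k c * f) m =
      (\<Sum>n\<in>Poly_Mapping.keys f. if k + n = m then c * Poly_Mapping.lookup f n else 0)"
    by (simp add: lookup_sum lookup_single when_def)
  also have "\<dots> = (if fst k \<le> fst m \<and> snd k \<le> snd m then c * Poly_Mapping.lookup f (fst m - fst k, snd m - snd k) else 0)"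
  proof (cases "fst k \<le> fst m \<and> snd k \<le> snd m")
    case True
    then have "k + n = m \<longleftrightarrow> (fst m - fst k, snd m - snd k) = n" for n
      by (cases k; cases m; cases n) auto
    then have "(\<Sum>n\<in>Poly_Mapping.keys f. if k + n = m then c * Poly_Mapping.lookup f n else 0) =
        (\<Sum>n\<in>Poly_Mapping.keys f. if (fst m - fst k, snd m - snd k) = n then c * Poly_Mapping.lookup f n else 0)"
      by simp
    then show ?thesis using True by (simp add: sum.delta' in_keys_iff)
  next
    case False
    then have "k + n \<noteq> m" for n by (cases k; cases m; cases n) auto
    then show ?thesis using False by auto
  qed
  finally show ?thesis .
qed

lemma single_eq_scale2: "Poly_Mapping.single m c = scale2 c (monom2 m)"
  by (simp add: scale2_def mult_single)

lemma poly2_span_monom: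
  fixes f :: "'k::field poly2"
  assumes "Poly_Mapping.keys f \<subseteq> N"
  shows "f \<in> poly2.span (monom2 ` N)"
proof -
  have "Poly_Mapping.single m (Poly_Mapping.lookup f m) \<in> poly2.span (monom2 ` N)"
    if "m \<in> Poly_Mapping.keys f" for m
    using assms that by (subst single_eq_scale2) (intro poly2.span_scale poly2.span_base, blast)
  then have "(\<Sum>m\<in>Poly_Mapping.keys f. Poly_Mapping.single m (Poly_Mapping.lookup f m)) \<in> poly2.span (monom2 ` N)"
    by (rule poly2.span_sum)
  then show ?thesis by (simp only: poly_mapping_sum_single)
qed

lemma keys_subset_iff: "Poly_Mapping.keys f \<subseteq> N \<longleftrightarrow> (\<forall>m. m \<notin> N \<longrightarrow> Poly_Mapping.lookup f m = 0)"
  by (auto simp: in_keys_iff)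

lemma keys_subset_subspace: "poly2.subspace {f. Poly_Mapping.keys f \<subseteq> N}"
  unfolding keys_subset_iff by (simp add: poly2.subspace_def lookup_add)

lemma poly2_span_monom_eq: "poly2.span (monom2 ` N) = {f. Poly_Mapping.keys f \<subseteq> N}"
proof
  show "poly2.span (monom2 ` N) \<subseteq> {f. Poly_Mapping.keys f \<subseteq> N}"
    by (intro poly2.span_minimal keys_subset_subspace) auto
  show "{f. Poly_Mapping.keys f \<subseteq> N} \<subseteq> poly2.span (monom2 ` N)"
    by (rule subsetI, rule poly2_span_monom) simp
qed

lemma inj_monom2: "inj_on (monom2 :: monomial \<Rightarrow> 'k::field poly2) N"
proof (rule inj_onI)
  fix m n :: monomial assume a: "(monom2 m :: 'k poly2) = monom2 n"
  show "m = n"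
    using arg_cong[OF a, of Poly_Mapping.keys]
    by (simp only: keys_single one_neq_zero if_False singleton_inject)
qed

lemma independent_monom2: "poly2.independent (monom2 ` N :: 'k::field poly2 set)"
  unfolding poly2.dependent_def
proof (rule notI, erule bexE)
  fix a :: "'k poly2" assume a: "a \<in> monom2 ` N" "a \<in> poly2.span (monom2 ` N - {a})"
  from a(1) obtain m where m: "a = monom2 m" "m \<in> N" by (rule imageE)
  have eq: "monom2 ` N - {a} = monom2 ` (N - {m})"
    unfolding m(1) using inj_on_image_set_diff[OF inj_monom2[of UNIV, where 'k = 'k] subset_UNIV subset_UNIV, of N "{m}"]
    by (simp only: image_insert image_empty)
  have "Poly_Mapping.keys a \<subseteq> N - {m}"
    using a(2) unfolding eq poly2_span_monom_eq by (simp only: mem_Collect_eq)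
  then show False unfolding m(1) by (simp only: keys_single one_neq_zero if_False) blast
qed

lemma dim_keys_subset:
  assumes "finite N"
  shows "poly2.dim {f :: 'k::field poly2. Poly_Mapping.keys f \<subseteq> N} = card N"
  using poly2.dim_span_eq_card_independent[OF independent_monom2[of N, where 'k = 'k]]
  by (simp add: poly2_span_monom_eq card_image[OF inj_monom2])

lemma ideal_scale2: "ideal.subspace I \<Longrightarrow> f \<in> I \<Longrightarrow> scale2 c f \<in> I"
  unfolding scale2_def by (rule ideal.subspace_scale)

lemma ideal_imp_poly2_subspace: "ideal.subspace I \<Longrightarrow> poly2.subspace I"
  by (simp add: poly2.subspace_def ideal_scale2 ideal.subspace_0 ideal.subspace_add)

lemma poly2_span_subset_ideal: "ideal.subspace I \<Longrightarrow> B \<subseteq> I \<Longrightarrow> poly2.span B \<subseteq> I"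
  by (intro poly2.span_minimal ideal_imp_poly2_subspace)

lemma monomial_ideal:
  fixes N :: "monomial set"
  assumes "\<And>m k. m \<in> N \<Longrightarrow> k + m \<in> N"
  shows "ideal.span (monom2 ` N :: 'k::field poly2 set) = {f. Poly_Mapping.keys f \<subseteq> N}"
proof
  have "ideal.subspace {f :: 'k poly2. Poly_Mapping.keys f \<subseteq> N}"
    unfolding ideal.subspace_def
  proof (intro conjI allI ballI)
    fix c x :: "'k poly2" assume "x \<in> {f. Poly_Mapping.keys f \<subseteq> N}"
    then show "c * x \<in> {f. Poly_Mapping.keys f \<subseteq> N}"
      using keys_mult[of c x] assms by (simp only: mem_Collect_eq subset_iff) metis
  next
    fix x y :: "'k poly2" assume "x \<in> {f. Poly_Mapping.keys f \<subseteq> N}" "y \<in> {f. Poly_Mapping.keys f \<subseteq> N}"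
    then show "x + y \<in> {f. Poly_Mapping.keys f \<subseteq> N}"
      using Poly_Mapping.keys_add[of x y] by blast
  qed simp
  then show "ideal.span (monom2 ` N :: 'k poly2 set) \<subseteq> {f. Poly_Mapping.keys f \<subseteq> N}"
    by (intro ideal.span_minimal) auto
  show "{f. Poly_Mapping.keys f \<subseteq> N} \<subseteq> ideal.span (monom2 ` N :: 'k poly2 set)"
    unfolding poly2_span_monom_eq[symmetric]
    by (rule poly2_span_subset_ideal[OF ideal.subspace_span ideal.span_superset])
qed

lemma forms_eq: "forms i = {f. Poly_Mapping.keys f \<subseteq> {m. deg m = i}}"
  by (auto simp: forms_def)

lemma finite_deg: "finite {m. deg m = i}"
proof (rule finite_subset)
  show "{m. deg m = i} \<subseteq> {..i} \<times> {..i}" by auto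
qed auto

lemma card_deg: "card {m. deg m = i} = Suc i"
proof -
  have "bij_betw (\<lambda>b. (i - b, b)) {..i} {m. deg m = i}"
    by (rule bij_betwI[where g = snd]) auto
  from bij_betw_same_card[OF this] show ?thesis by simp
qed

lemma forms_subspace: "poly2.subspace (forms i)"
  unfolding forms_eq by (rule keys_subset_subspace)

lemma hilbert_function_monomial:
  fixes N :: "monomial set"
  assumes "\<And>m k. m \<in> N \<Longrightarrow> k + m \<in> N"
  shows "hilbert_function (ideal.span (monom2 ` N :: 'k::field poly2 set)) i = card ({m. deg m = i} - N)"
proof -
  have "ideal.span (monom2 ` N :: 'k poly2 set) \<inter> forms i = {f. Poly_Mapping.keys f \<subseteq> {m. deg m = i} \<inter> N}"
    by (subst monomial_ideal) (use assms in \<open>auto simp: forms_eq\<close>)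
  then show ?thesis
    using dim_keys_subset[OF finite_deg[of i], where 'k = 'k]
      dim_keys_subset[of "{m. deg m = i} \<inter> N", where 'k = 'k] finite_deg[of i]
    unfolding hilbert_function_def by (simp only: forms_eq finite_Int card_Diff_subset_Int simp_thms)
qed

lemma initial_monomial_props:
  assumes "f \<noteq> 0"
  shows "initial_monomial f \<in> Poly_Mapping.keys f"
    "m \<in> Poly_Mapping.keys f \<Longrightarrow> snd m \<le> snd (initial_monomial f)"
proof -
  have "finite (snd ` Poly_Mapping.keys f)" "snd ` Poly_Mapping.keys f \<noteq> {}" using assms by auto
  then have "Max (snd ` Poly_Mapping.keys f) \<in> snd ` Poly_Mapping.keys f" by (rule Max_in)
  then obtain m0 where m0: "m0 \<in> Poly_Mapping.keys f" "snd m0 = Max (snd ` Poly_Mapping.keys f)"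
    by (elim imageE) simp
  have "snd m \<le> snd m0" if "m \<in> Poly_Mapping.keys f" for m
    unfolding m0(2) using that by (intro Max_ge) auto
  then have "is_arg_max snd (\<lambda>m. m \<in> Poly_Mapping.keys f) m0"
    using m0(1) by (simp add: is_arg_max_linorder del: split_paired_All)
  then have *: "is_arg_max snd (\<lambda>m. m \<in> Poly_Mapping.keys f) (initial_monomial f)"
    unfolding initial_monomial_def arg_max_on_def arg_max_def by (rule someI)
  then show "initial_monomial f \<in> Poly_Mapping.keys f" by (simp add: is_arg_max_def)
  show "m \<in> Poly_Mapping.keys f \<Longrightarrow> snd m \<le> snd (initial_monomial f)"
    using * by (simp add: is_arg_max_linorder del: split_paired_All)
qed

lemma initial_monomial_eqI:
  assumes "f \<in> forms i" "m \<in> Poly_Mapping.keys f" "\<And>m'. m' \<in> Poly_Mapping.keys f \<Longrightarrow> snd m' \<le> snd m"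
  shows "initial_monomial f = m"
proof -
  have "f \<noteq> 0" using assms(2) by auto
  note ip = initial_monomial_props[OF this]
  have "snd (initial_monomial f) = snd m" using ip(2)[OF assms(2)] assms(3)[OF ip(1)] by simp
  moreover have "deg (initial_monomial f) = deg m" using assms(1,2) ip(1) unfolding forms_eq by blast
  ultimately show ?thesis by (simp add: prod_eq_iff)
qed

section \<open>The ideals of the Jordan cell\<close>

text \<open>The shape that diagonal lengths \<open>1, 2, \<dots>, d, t, 0\<close> force: only the monomials of degree \<open>d\<close> carry
  information.\<close>

locale top_degree_cell =
  fixes P :: "nat list" and d :: nat
  assumes low: "deg m < d \<Longrightarrow> m \<in> cells P"
    and high: "d < deg m \<Longrightarrow> m \<notin> cells P"
begin

text \<open>The \<open>y\<close>-degrees of the initial monomials that an ideal of the cell has in degree \<open>d\<close>.\<close>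

definition S :: "nat set" where "S = {b. b \<le> d \<and> (d - b, b) \<notin> cells P}"

lemma S_le: "b \<in> S \<Longrightarrow> b \<le> d" by (simp add: S_def)

lemma finite_S [simp]: "finite S"
  by (rule finite_subset[of _ "{..d}"]) (auto simp: S_def)

lemma not_cells_upward: "m \<notin> cells P \<Longrightarrow> k + m \<notin> cells P"
proof (cases "k = 0")
  case False
  assume "m \<notin> cells P"
  then have "d \<le> deg m" using low not_le by blast
  moreover have "0 < deg k" using False by (cases k) (auto simp: zero_prod_def)
  ultimately have "d < deg (k + m)" by (simp only: fst_add snd_add)
  then show ?thesis by (rule high)
qed simp

lemma E_ideal_eq: "(E_ideal P :: 'k::field poly2 set) = {f. Poly_Mapping.keys f \<subseteq> - cells P}"
  unfolding E_ideal_def by (rule monomial_ideal) (use not_cells_upward in auto)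

definition basis_form :: "(nat \<Rightarrow> nat \<Rightarrow> 'k::field) \<Rightarrow> nat \<Rightarrow> 'k poly2" where
  "basis_form c b = monom2 (d - b, b) + (\<Sum>a\<in>{..<b} - S. Poly_Mapping.single (d - a, a) (c b a))"

text \<open>The ideal of the cell with coefficients \<open>c\<close>, given by linear equations: a form of degree \<open>d\<close> lies in
  the span of the echelon basis if and only if its coefficients outside \<open>S\<close> are the combinations of
  the coefficients in \<open>S\<close> prescribed by \<open>c\<close>.\<close>

definition cell_ideal :: "(nat \<Rightarrow> nat \<Rightarrow> 'k::field) \<Rightarrow> 'k poly2 set" where
  "cell_ideal c = {f. (\<forall>m. deg m < d \<longrightarrow> Poly_Mapping.lookup f m = 0) \<and>
     (\<forall>a\<in>{..d} - S. Poly_Mapping.lookup f (d - a, a) = (\<Sum>b\<in>S. if a < b then c b a * Poly_Mapping.lookup f (d - b, b) else 0))}"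

lemma cell_idealD:
  assumes "f \<in> cell_ideal c"
  shows "deg m < d \<Longrightarrow> Poly_Mapping.lookup f m = 0"
    and "a \<le> d \<Longrightarrow> a \<notin> S \<Longrightarrow> Poly_Mapping.lookup f (d - a, a) = (\<Sum>b\<in>S. if a < b then c b a * Poly_Mapping.lookup f (d - b, b) else 0)"
  using assms unfolding cell_ideal_def by blast+

lemma lookup_basis_form:
  assumes "b \<le> d"
  shows "Poly_Mapping.lookup (basis_form c b) m =
    (if deg m \<noteq> d then 0 else if snd m = b then 1 else if snd m < b \<and> snd m \<notin> S then c b (snd m) else 0)"
proof -
  obtain i a where m: "m = (i, a)" by (cases m)
  have "Poly_Mapping.lookup (basis_form c b) m = (if d - b = i \<and> b = a then 1 else 0) +
      (\<Sum>a'\<in>{..<b} - S. if d - a' = i \<and> a' = a then c b a' else 0)"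
    by (simp add: basis_form_def lookup_add lookup_sum lookup_single when_def m)
  also have "(\<Sum>a'\<in>{..<b} - S. if d - a' = i \<and> a' = a then c b a' else 0) =
      (\<Sum>a'\<in>{..<b} - S. if a = a' then (if d - a = i then c b a else 0) else 0)"
    by (rule sum.cong) auto
  also have "\<dots> = (if a < b \<and> a \<notin> S \<and> d - a = i then c b a else 0)"
    by (subst sum.delta') auto
  finally show ?thesis using assms by (auto simp: m)
qed

lemma basis_form_forms: "b \<le> d \<Longrightarrow> basis_form c b \<in> forms d"
  by (auto simp: forms_eq in_keys_iff lookup_basis_form split: if_splits)

lemma basis_form_in:
  assumes "b \<in> S" shows "basis_form c b \<in> cell_ideal c"
  unfolding cell_ideal_def
proof (rule CollectI, intro conjI ballI allI impI)
  fix m :: monomial assume "deg m < d" 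
  then show "Poly_Mapping.lookup (basis_form c b) m = 0" using S_le[OF assms] by (simp add: lookup_basis_form)
next
  fix a assume a: "a \<in> {..d} - S"
  have "(\<Sum>b'\<in>S. if a < b' then c b' a * Poly_Mapping.lookup (basis_form c b) (d - b', b') else 0) =
     (\<Sum>b'\<in>S. if b = b' then (if a < b then c b a else 0) else 0)"
    by (rule sum.cong) (use S_le assms in \<open>auto simp: lookup_basis_form\<close>)
  also have "\<dots> = Poly_Mapping.lookup (basis_form c b) (d - a, a)"
    using a assms S_le[OF assms] by (auto simp: lookup_basis_form)
  finally show "Poly_Mapping.lookup (basis_form c b) (d - a, a) = 
    (\<Sum>b'\<in>S. if a < b' then c b' a * Poly_Mapping.lookup (basis_form c b) (d - b', b') else 0)" ..
qed

lemma monom_in_cell_ideal: "d < deg m \<Longrightarrow> monom2 m \<in> cell_ideal c"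
  by (auto simp: cell_ideal_def lookup_single when_def S_le intro!: sum.neutral)

text \<open>For a polynomial without terms of degree below \<open>d\<close>, multiplication by \<open>r\<close> acts on the part of degree
  at most \<open>d\<close> through the constant term of \<open>r\<close>.\<close>

lemma lookup_mult_low:
  fixes f r :: "'k::field poly2"
  assumes "\<And>m. deg m < d \<Longrightarrow> Poly_Mapping.lookup f m = 0" "deg m \<le> d"
  shows "Poly_Mapping.lookup (r * f) m = Poly_Mapping.lookup r 0 * Poly_Mapping.lookup f m"
proof -
  have "r * f = (\<Sum>k\<in>Poly_Mapping.keys r. Poly_Mapping.single k (Poly_Mapping.lookup r k) * f)"
    by (subst (1) poly_mapping_sum_single[of r, symmetric]) (simp add: sum_distrib_right)
  then have "Poly_Mapping.lookup (r * f) m =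
      (\<Sum>k\<in>Poly_Mapping.keys r. Poly_Mapping.lookup (Poly_Mapping.single k (Poly_Mapping.lookup r k) * f) m)"
    by (simp add: lookup_sum)
  also have "\<dots> = (\<Sum>k\<in>Poly_Mapping.keys r. if 0 = k then Poly_Mapping.lookup r 0 * Poly_Mapping.lookup f m else 0)"
  proof (rule sum.cong)
    fix k :: monomial
    show "Poly_Mapping.lookup (Poly_Mapping.single k (Poly_Mapping.lookup r k) * f) m =
        (if 0 = k then Poly_Mapping.lookup r 0 * Poly_Mapping.lookup f m else 0)"
    proof (cases "k = 0")
      case False
      then have "0 < deg k" by (cases k) (auto simp: zero_prod_def)
      then have "fst k \<le> fst m \<and> snd k \<le> snd m \<Longrightarrow> Poly_Mapping.lookup f (fst m - fst k, snd m - snd k) = 0"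
        using assms(2) by (intro assms(1)) auto
      then show ?thesis using False by (simp add: lookup_single_mult)
    qed (simp add: lookup_single_mult)
  qed simp
  also have "\<dots> = Poly_Mapping.lookup r 0 * Poly_Mapping.lookup f m"
    by (subst sum.delta') (auto simp: in_keys_iff)
  finally show ?thesis .
qed

lemma cell_ideal_ideal: "ideal.subspace (cell_ideal c)"
  unfolding ideal.subspace_def
proof (intro conjI ballI allI)
  show "0 \<in> cell_ideal c" by (auto simp: cell_ideal_def intro!: sum.neutral)
  fix f g assume "f \<in> cell_ideal c" "g \<in> cell_ideal c"
  then show "f + g \<in> cell_ideal c"
    by (auto simp: cell_ideal_def lookup_add distrib_left sum.distrib[symmetric] intro!: sum.cong)
next
  fix r f assume f: "f \<in> cell_ideal c"
  have l: "Poly_Mapping.lookup (r * f) m = Poly_Mapping.lookup r 0 * Poly_Mapping.lookup f m" if "deg m \<le> d" for m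
    using f that by (intro lookup_mult_low) (auto simp: cell_ideal_def)
  show "r * f \<in> cell_ideal c"
    using f by (auto simp: cell_ideal_def l S_le sum_distrib_left intro!: sum.cong)
qed

lemma cell_ideal_decomp:
  assumes "f \<in> cell_ideal c"
  shows "Poly_Mapping.keys (f - (\<Sum>b\<in>S. scale2 (Poly_Mapping.lookup f (d - b, b)) (basis_form c b))) \<subseteq> {m. d < deg m}"
  unfolding keys_subset_iff
proof (intro allI impI)
  fix m :: monomial assume "m \<notin> {m. d < deg m}"
  then have m: "deg m \<le> d" by simp
  have l: "Poly_Mapping.lookup (f - (\<Sum>b\<in>S. scale2 (Poly_Mapping.lookup f (d - b, b)) (basis_form c b))) m =
     Poly_Mapping.lookup f m - (\<Sum>b\<in>S. Poly_Mapping.lookup f (d - b, b) * Poly_Mapping.lookup (basis_form c b) m)"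
    by (simp add: lookup_minus lookup_sum)
  show "Poly_Mapping.lookup (f - (\<Sum>b\<in>S. scale2 (Poly_Mapping.lookup f (d - b, b)) (basis_form c b))) m = 0"
  proof (cases "deg m = d")
    case False
    then have "deg m < d" using m by simp
    moreover have "(\<Sum>b\<in>S. Poly_Mapping.lookup f (d - b, b) * Poly_Mapping.lookup (basis_form c b) m) = 0"
      using False S_le by (intro sum.neutral) (auto simp: lookup_basis_form)
    ultimately show ?thesis unfolding l using cell_idealD(1)[OF assms] by simp
  next
    case True
    define a where "a = snd m"
    have ma: "m = (d - a, a)" "a \<le> d" using True by (auto simp: a_def prod_eq_iff)
    show ?thesis
    proof (cases "a \<in> S")
      case True
      have "(\<Sum>b\<in>S. Poly_Mapping.lookup f (d - b, b) * Poly_Mapping.lookup (basis_form c b) m) =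
        (\<Sum>b\<in>S. if a = b then Poly_Mapping.lookup f m else 0)"
        by (rule sum.cong) (use True S_le ma in \<open>auto simp: lookup_basis_form\<close>)
      then show ?thesis unfolding l using True by simp
    next
      case False
      have "(\<Sum>b\<in>S. Poly_Mapping.lookup f (d - b, b) * Poly_Mapping.lookup (basis_form c b) m) =
        (\<Sum>b\<in>S. if a < b then c b a * Poly_Mapping.lookup f (d - b, b) else 0)"
        by (rule sum.cong) (use False S_le ma in \<open>auto simp: lookup_basis_form\<close>)
      also have "\<dots> = Poly_Mapping.lookup f m"
        using assms False ma by (simp add: cell_ideal_def)
      finally show ?thesis unfolding l by simp
    qed
  qed
qed

lemma cell_ideal_span:
  "cell_ideal c = poly2.span (basis_form c ` S \<union> monom2 ` {m. d < deg m})"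
proof
  show "poly2.span (basis_form c ` S \<union> monom2 ` {m. d < deg m}) \<subseteq> cell_ideal c"
    by (rule poly2_span_subset_ideal[OF cell_ideal_ideal]) (use basis_form_in monom_in_cell_ideal in blast)
  show "cell_ideal c \<subseteq> poly2.span (basis_form c ` S \<union> monom2 ` {m. d < deg m})"
  proof
    fix f assume f: "f \<in> cell_ideal c"
    let ?s = "\<Sum>b\<in>S. scale2 (Poly_Mapping.lookup f (d - b, b)) (basis_form c b)"
    have "f - ?s \<in> poly2.span (basis_form c ` S \<union> monom2 ` {m. d < deg m})"
      using poly2_span_monom[OF cell_ideal_decomp[OF f]] by (rule subsetD[OF poly2.span_mono, rotated]) blast
    moreover have "?s \<in> poly2.span (basis_form c ` S \<union> monom2 ` {m. d < deg m})"
      by (intro poly2.span_sum poly2.span_scale poly2.span_base) blast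
    ultimately have "(f - ?s) + ?s \<in> poly2.span (basis_form c ` S \<union> monom2 ` {m. d < deg m})"
      by (rule poly2.span_add)
    then show "f \<in> poly2.span (basis_form c ` S \<union> monom2 ` {m. d < deg m})" by simp
  qed
qed

lemma cell_ideal_graded: "graded_ideal (cell_ideal c)"
  unfolding graded_ideal_def
proof
  show "ideal.subspace (cell_ideal c)" by (rule cell_ideal_ideal)
  let ?H = "cell_ideal c \<inter> (\<Union>i. forms i)"
  have "basis_form c ` S \<union> monom2 ` {m. d < deg m} \<subseteq> ?H"
  proof -
    have "monom2 m \<in> forms (deg m)" for m by (auto simp: forms_eq)
    then show ?thesis using basis_form_in basis_form_forms S_le monom_in_cell_ideal by blast
  qed
  then have "cell_ideal c \<subseteq> ideal.span ?H"
    by (subst (1) cell_ideal_span)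
      (rule poly2_span_subset_ideal[OF ideal.subspace_span], use ideal.span_superset[of ?H] in blast)
  moreover have "ideal.span ?H \<subseteq> cell_ideal c"
    by (intro ideal.span_minimal cell_ideal_ideal) blast
  ultimately show "cell_ideal c = ideal.span ?H" by blast
qed

lemma initial_monomial_basis_form:
  assumes "b \<le> d" shows "initial_monomial (basis_form c b) = (d - b, b)"
  using assms by (intro initial_monomial_eqI[OF basis_form_forms])
    (auto simp: in_keys_iff lookup_basis_form split: if_splits)

lemma cell_ideal_initial: "initial_ideal (cell_ideal c :: 'k::field poly2 set) = E_ideal P"
proof
  have "monom2 (initial_monomial f) \<in> E_ideal P" if f: "f \<in> cell_ideal c" "f \<in> forms i" "f \<noteq> 0" for f :: "'k poly2" and i
  proof -
    let ?m = "initial_monomial f"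
    note ip = initial_monomial_props[OF f(3)]
    have "?m \<notin> cells P"
    proof
      assume m: "?m \<in> cells P"
      then have "deg ?m \<le> d" using high not_le by blast
      moreover have "\<not> deg ?m < d" using ip(1) cell_idealD(1)[OF f(1), of ?m] by (auto simp: in_keys_iff)
      ultimately have dm: "deg ?m = d" by simp
      define a where "a = snd ?m"
      have ma: "?m = (d - a, a)" "a \<in> {..d} - S" using dm m by (auto simp: a_def prod_eq_iff S_def)
      have "Poly_Mapping.lookup f ?m = (\<Sum>b\<in>S. if a < b then c b a * Poly_Mapping.lookup f (d - b, b) else 0)"
        using f(1) ma by (simp add: cell_ideal_def)
      also have "\<dots> = 0"
        using ip(2) by (intro sum.neutral) (fastforce simp: in_keys_iff a_def)
      finally show False using ip(1) by (simp add: in_keys_iff)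
    qed
    then show ?thesis by (simp add: E_ideal_eq)
  qed
  moreover have "ideal.subspace (E_ideal P :: 'k poly2 set)" unfolding E_ideal_def by (rule ideal.subspace_span)
  ultimately show "initial_ideal (cell_ideal c) \<subseteq> (E_ideal P :: 'k poly2 set)"
    unfolding initial_ideal_def by (intro ideal.span_minimal) auto
  have "\<exists>f i. f \<in> cell_ideal c \<and> f \<in> forms i \<and> f \<noteq> 0 \<and> initial_monomial f = m" if m: "m \<notin> cells P" for m
  proof (cases "d < deg m")
    case True
    have "monom2 m \<in> forms (deg m)" by (auto simp: forms_eq)
    moreover from this have "initial_monomial (monom2 m :: 'k poly2) = m" by (rule initial_monomial_eqI) auto
    moreover have "monom2 m \<noteq> (0 :: 'k poly2)" by (metis keys_single keys_zero insert_not_empty one_neq_zero)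
    ultimately show ?thesis using monom_in_cell_ideal[OF True, of c] by blast
  next
    case False
    then have "deg m = d" using low m by (metis linorder_neqE_nat)
    define b where "b = snd m"
    have b: "m = (d - b, b)" "b \<in> S" using m \<open>deg m = d\<close> by (auto simp: b_def prod_eq_iff S_def)
    have "Poly_Mapping.lookup (basis_form c b) m = 1" using b S_le by (simp add: lookup_basis_form)
    then have "basis_form c b \<noteq> 0" by auto
    then show ?thesis using basis_form_in[OF b(2)] basis_form_forms[OF S_le[OF b(2)]]
      initial_monomial_basis_form[OF S_le[OF b(2)]] b by metis
  qed
  then show "(E_ideal P :: 'k poly2 set) \<subseteq> initial_ideal (cell_ideal c)"
    unfolding E_ideal_def initial_ideal_def
    by (intro ideal.span_mono subsetI) (elim imageE, metis (mono_tags, lifting) ComplD mem_Collect_eq)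
qed

lemma cell_ideal_in_cell: "cell_ideal c \<in> jordan_cell P"
  by (simp add: jordan_cell_def cell_ideal_graded cell_ideal_initial)

text \<open>The initial ideal is generated by the monomials \<open>initial_monomial f\<close>, so \<open>m\<close> is a multiple of one of
  them, and the same multiple of \<open>f\<close>, normalized, is the required form.\<close>

lemma form_with_initial:
  fixes I :: "'k::field poly2 set"
  assumes I: "ideal.subspace I" "E_ideal P \<subseteq> initial_ideal I" and m: "m \<notin> cells P"
  obtains g where "g \<in> I" "g \<in> forms (deg m)" "Poly_Mapping.lookup g m = 1" "\<And>n. n \<in> Poly_Mapping.keys g \<Longrightarrow> snd n \<le> snd m"
proof -
  define N0 where "N0 = {initial_monomial f | f i. f \<in> I \<and> f \<in> forms i \<and> f \<noteq> 0}"
  define N where "N = {k + n | k n. n \<in> N0}"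
  have N_up: "k + n \<in> N" if n: "n \<in> N" for k n
  proof -
    from n obtain k' n' where "n = k' + n'" "n' \<in> N0" unfolding N_def by blast
    then have "k + n = (k + k') + n'" "n' \<in> N0" by (simp_all only: add.assoc)
    then show ?thesis unfolding N_def by blast
  qed
  have "N0 \<subseteq> N"
  proof
    fix n assume "n \<in> N0" moreover have "n = 0 + n" by simp
    ultimately show "n \<in> N" unfolding N_def by blast
  qed
  have "monom2 m \<in> (E_ideal P :: 'k poly2 set)" using m by (simp add: E_ideal_eq)
  also have "\<dots> \<subseteq> initial_ideal I" by (rule I)
  also have "initial_ideal I = ideal.span (monom2 ` N0)"
    unfolding initial_ideal_def N0_def by (rule arg_cong[of _ _ ideal.span]) blast
  also have "\<dots> \<subseteq> ideal.span (monom2 ` N)" using \<open>N0 \<subseteq> N\<close> by (intro ideal.span_mono image_mono)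
  also have "\<dots> = {f. Poly_Mapping.keys f \<subseteq> N}" by (rule monomial_ideal) (rule N_up)
  finally have "m \<in> N" by simp
  then obtain k f i where f: "f \<in> I" "f \<in> forms i" "f \<noteq> 0" "m = k + initial_monomial f"
    unfolding N_def N0_def by blast
  note ip = initial_monomial_props[OF f(3)]
  let ?c = "inverse (Poly_Mapping.lookup f (initial_monomial f))"
  let ?g = "Poly_Mapping.single k ?c * f"
  have key: "fst k \<le> fst n \<and> snd k \<le> snd n \<and> (fst n - fst k, snd n - snd k) \<in> Poly_Mapping.keys f"
    if "n \<in> Poly_Mapping.keys ?g" for n
    using that by (simp add: in_keys_iff lookup_single_mult split: if_splits)
  have deg_key: "deg n = i" if "n \<in> Poly_Mapping.keys f" for n using f(2) that unfolding forms_eq by blast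
  show ?thesis
  proof
    show "?g \<in> I" by (rule ideal.subspace_scale[OF I(1) f(1)])
    show "?g \<in> forms (deg m)"
      unfolding forms_eq
    proof (rule CollectI, rule subsetI, rule CollectI)
      fix n assume n: "n \<in> Poly_Mapping.keys ?g"
      show "deg n = deg m"
        using key[OF n] deg_key[OF ip(1)] deg_key[of "(fst n - fst k, snd n - snd k)"]
        unfolding f(4) fst_add snd_add fst_conv snd_conv by linarith
    qed
    show "Poly_Mapping.lookup ?g m = 1"
    proof -
      have "fst m - fst k = fst (initial_monomial f)" "snd m - snd k = snd (initial_monomial f)"
        "fst k \<le> fst m" "snd k \<le> snd m"
        unfolding f(4) fst_add snd_add by simp_all
      then show ?thesis using ip(1) by (simp only: lookup_single_mult in_keys_iff) simp
    qed
    show "snd n \<le> snd m" if "n \<in> Poly_Mapping.keys ?g" for n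
      using key[OF that] ip(2)[of "(fst n - fst k, snd n - snd k)"]
      unfolding f(4) snd_add snd_conv by linarith
  qed
qed

text \<open>Reduction to echelon form, from low to high \<open>y\<close>-degree: subtract from a form with the right initial
  monomial the reduced forms that belong to its lower terms outside \<open>cells P\<close>. In degrees above \<open>d\<close>,
  where there are no cells, the result is the monomial itself.\<close>

lemma reduced_form:
  fixes I :: "'k::field poly2 set"
  assumes I: "ideal.subspace I" "E_ideal P \<subseteq> initial_ideal I" and b: "b \<le> e" "(e - b, b) \<notin> cells P"
  shows "\<exists>h\<in>I. h \<in> forms e \<and> Poly_Mapping.lookup h (e - b, b) = 1 \<and>
    (\<forall>n\<in>Poly_Mapping.keys h. n \<noteq> (e - b, b) \<longrightarrow> snd n < b \<and> n \<in> cells P)"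
  using b
proof (induction b rule: less_induct)
  case (less b)
  define B where "B = {a. a < b \<and> (e - a, a) \<notin> cells P}"
  have "finite B" unfolding B_def by (rule finite_subset[of _ "{..<b}"]) auto
  have "\<forall>a\<in>B. \<exists>h\<in>I. h \<in> forms e \<and> Poly_Mapping.lookup h (e - a, a) = 1 \<and>
    (\<forall>n\<in>Poly_Mapping.keys h. n \<noteq> (e - a, a) \<longrightarrow> snd n < a \<and> n \<in> cells P)"
    using less.IH less.prems(1) unfolding B_def by simp
  then obtain hh where hh: "\<And>a. a \<in> B \<Longrightarrow> hh a \<in> I" "\<And>a. a \<in> B \<Longrightarrow> hh a \<in> forms e"
    "\<And>a. a \<in> B \<Longrightarrow> Poly_Mapping.lookup (hh a) (e - a, a) = 1"
    "\<And>a n. a \<in> B \<Longrightarrow> n \<in> Poly_Mapping.keys (hh a) \<Longrightarrow> n \<noteq> (e - a, a) \<Longrightarrow> snd n < a \<and> n \<in> cells P"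
    by metis
  have deg_eb: "deg (e - b, b) = e" using less.prems(1) by simp
  obtain g where g: "g \<in> I" "g \<in> forms e" "Poly_Mapping.lookup g (e - b, b) = 1"
    "\<And>n. n \<in> Poly_Mapping.keys g \<Longrightarrow> snd n \<le> b"
    using form_with_initial[OF I less.prems(2)] unfolding deg_eb by auto
  define h where "h = g - (\<Sum>a\<in>B. scale2 (Poly_Mapping.lookup g (e - a, a)) (hh a))"
  have lh: "Poly_Mapping.lookup h n = Poly_Mapping.lookup g n - (\<Sum>a\<in>B. Poly_Mapping.lookup g (e - a, a) * Poly_Mapping.lookup (hh a) n)" for n
    by (simp add: h_def lookup_minus lookup_sum)
  have "h \<in> I" unfolding h_def
    by (intro poly2.subspace_diff poly2.subspace_sum poly2.subspace_scale ideal_imp_poly2_subspace I g hh)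
  moreover have hf: "h \<in> forms e" unfolding h_def
    by (intro poly2.subspace_diff poly2.subspace_sum poly2.subspace_scale forms_subspace g hh)
  moreover have high0: "Poly_Mapping.lookup h n = Poly_Mapping.lookup g n" if "b \<le> snd n" for n
  proof -
    have "Poly_Mapping.lookup (hh a) n = 0" if a: "a \<in> B" for a
    proof (rule ccontr)
      assume "Poly_Mapping.lookup (hh a) n \<noteq> 0"
      then have "snd n \<le> a" using hh(4)[OF a, of n] by (cases "n = (e - a, a)") (auto simp: in_keys_iff)
      then show False using a \<open>b \<le> snd n\<close> unfolding B_def by simp
    qed
    then show ?thesis by (simp add: lh)
  qed
  moreover have "snd n < b \<and> n \<in> cells P" if n: "n \<in> Poly_Mapping.keys h" "n \<noteq> (e - b, b)" for n
  proof -
    have "deg n = e" using hf n(1) unfolding forms_eq by blast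
    define a where "a = snd n"
    have na: "n = (e - a, a)" using \<open>deg n = e\<close> by (auto simp: a_def prod_eq_iff)
    have "a < b"
    proof (rule ccontr)
      assume "\<not> a < b"
      then have "Poly_Mapping.lookup g n \<noteq> 0" using high0[of n] n(1) by (simp add: a_def in_keys_iff)
      then have "a \<le> b" using g(4)[of n] by (simp add: a_def in_keys_iff)
      then show False using na n(2) \<open>\<not> a < b\<close> by simp
    qed
    moreover have "n \<in> cells P"
    proof (rule ccontr)
      assume nc: "n \<notin> cells P"
      then have "a \<in> B" using \<open>a < b\<close> na by (simp add: B_def)
      have "(\<Sum>a'\<in>B. Poly_Mapping.lookup g (e - a', a') * Poly_Mapping.lookup (hh a') n) =
        (\<Sum>a'\<in>B. if a = a' then Poly_Mapping.lookup g n else 0)"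
      proof (rule sum.cong)
        fix a' assume a': "a' \<in> B"
        show "Poly_Mapping.lookup g (e - a', a') * Poly_Mapping.lookup (hh a') n = (if a = a' then Poly_Mapping.lookup g n else 0)"
        proof (cases "a = a'")
          case True
          then show ?thesis using hh(3)[OF a'] na by simp
        next
          case False
          then have "n \<notin> Poly_Mapping.keys (hh a')" using hh(4)[OF a', of n] nc na by auto
          then show ?thesis using False by (simp add: in_keys_iff)
        qed
      qed simp
      also have "\<dots> = Poly_Mapping.lookup g n" using \<open>a \<in> B\<close> \<open>finite B\<close> by (simp add: sum.delta')
      finally show False using n(1) lh[of n] by (simp add: in_keys_iff)
    qed
    ultimately show ?thesis by (simp add: a_def)
  qed
  ultimately show ?case using g(3) by (intro bexI[of _ h]) auto
qed

text \<open>The coefficients of the reduced forms of degree \<open>d\<close> are the parameters \<open>c\<close>. A form of \<open>I\<close> has no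
  cell as initial monomial; applied to a form of degree \<open>d\<close> minus its projection to the span of the
  basis, this shows that \<open>I\<close> is not larger than \<open>cell_ideal c\<close>.\<close>

lemma jordan_cell_cases:
  fixes I :: "'k::field poly2 set"
  assumes "I \<in> jordan_cell P"
  obtains c where "I = cell_ideal c"
proof -
  have I: "ideal.subspace I" "I = ideal.span (I \<inter> (\<Union>i. forms i))" "initial_ideal I = E_ideal P"
    using assms by (auto simp: jordan_cell_def graded_ideal_def)
  note red = reduced_form[OF I(1) equalityD2[OF I(3)]]
  have "\<forall>b\<in>S. \<exists>h\<in>I. h \<in> forms d \<and> Poly_Mapping.lookup h (d - b, b) = 1 \<and>
    (\<forall>n\<in>Poly_Mapping.keys h. n \<noteq> (d - b, b) \<longrightarrow> snd n < b \<and> n \<in> cells P)"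
    using red by (simp add: S_def)
  then obtain h where h: "\<And>b. b \<in> S \<Longrightarrow> h b \<in> I" "\<And>b. b \<in> S \<Longrightarrow> h b \<in> forms d"
    "\<And>b. b \<in> S \<Longrightarrow> Poly_Mapping.lookup (h b) (d - b, b) = 1"
    "\<And>b n. b \<in> S \<Longrightarrow> n \<in> Poly_Mapping.keys (h b) \<Longrightarrow> n \<noteq> (d - b, b) \<Longrightarrow> snd n < b \<and> n \<in> cells P"
    by metis
  define c where "c b a = Poly_Mapping.lookup (h b) (d - a, a)" for b a
  have bf: "basis_form c b = h b" if b: "b \<in> S" for b
  proof (rule poly_mapping_eqI)
    fix m :: monomial
    show "Poly_Mapping.lookup (basis_form c b) m = Poly_Mapping.lookup (h b) m"
    proof (cases "deg m = d")
      case False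
      then have "m \<notin> Poly_Mapping.keys (h b)" using h(2)[OF b] unfolding forms_eq by blast
      then show ?thesis using False S_le[OF b] by (simp add: lookup_basis_form in_keys_iff)
    next
      case True
      define a where "a = snd m"
      have ma: "m = (d - a, a)" "a \<le> d" using True by (auto simp: a_def prod_eq_iff)
      have "m \<notin> Poly_Mapping.keys (h b)" if "a \<noteq> b" "\<not> a < b \<or> a \<in> S"
        using h(4)[OF b, of m] that ma by (auto simp: S_def)
      then show ?thesis using S_le[OF b] h(3)[OF b] ma
        by (auto simp: lookup_basis_form in_keys_iff c_def)
    qed
  qed
  have mono: "monom2 m \<in> I" if m: "d < deg m" for m
  proof -
    have mm: "(deg m - snd m, snd m) = m" by (simp add: prod_eq_iff)
    obtain g where g: "g \<in> I" "g \<in> forms (deg m)" "Poly_Mapping.lookup g m = 1"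
      "\<forall>n\<in>Poly_Mapping.keys g. n \<noteq> m \<longrightarrow> snd n < snd m \<and> n \<in> cells P"
      using red[of "snd m" "deg m"] high[OF m] unfolding mm by auto
    have "g = monom2 m"
    proof (rule poly_mapping_eqI)
      fix n
      have "n \<notin> Poly_Mapping.keys g" if "n \<noteq> m"
        using that g(2,4) high[of n] m unfolding forms_eq by fastforce
      then show "Poly_Mapping.lookup g n = Poly_Mapping.lookup (monom2 m) n"
        using g(3) by (cases "n = m") (simp_all add: in_keys_iff lookup_single when_def)
    qed
    then show ?thesis using g(1) by simp
  qed
  have ini: "initial_monomial f \<notin> cells P" if "f \<in> I" "f \<in> forms i" "f \<noteq> 0" for f i
  proof -
    have "monom2 (initial_monomial f) \<in> initial_ideal I"
      unfolding initial_ideal_def using that by (intro ideal.span_base) blast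
    then show ?thesis unfolding I(3) E_ideal_eq by simp
  qed
  have "cell_ideal c \<subseteq> I"
    unfolding cell_ideal_span
    by (rule poly2_span_subset_ideal[OF I(1)]) (use bf h(1) mono in auto)
  moreover have "I \<subseteq> cell_ideal c"
  proof (subst I(2), rule ideal.span_minimal[OF _ cell_ideal_ideal], rule subsetI)
    fix g assume "g \<in> I \<inter> (\<Union>i. forms i)"
    then obtain e where g: "g \<in> I" "g \<in> forms e" by blast
    have gdeg: "deg n = e" if "n \<in> Poly_Mapping.keys g" for n using g(2) that unfolding forms_eq by blast
    consider "g = 0" | "g \<noteq> 0" "d < e" | "g \<noteq> 0" "e = d"
      using ini[OF g] gdeg[OF initial_monomial_props(1)] low by (metis linorder_neqE_nat)
    then show "g \<in> cell_ideal c"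
    proof cases
      case 1
      then show ?thesis using ideal.subspace_0[OF cell_ideal_ideal] by simp
    next
      case 2
      then have "Poly_Mapping.keys g \<subseteq> {m. d < deg m}" using gdeg by blast
      then have "g \<in> poly2.span (monom2 ` {m. d < deg m})" by (rule poly2_span_monom)
      then show ?thesis unfolding cell_ideal_span by (rule subsetD[OF poly2.span_mono, rotated]) blast
    next
      case 3
      define s where "s = (\<Sum>b\<in>S. scale2 (Poly_Mapping.lookup g (d - b, b)) (basis_form c b))"
      have s: "s \<in> cell_ideal c" unfolding s_def
        by (intro poly2.subspace_sum poly2.subspace_scale ideal_imp_poly2_subspace cell_ideal_ideal basis_form_in)
      have "g - s = 0"
      proof (rule ccontr)
        assume ne: "g - s \<noteq> 0"
        have "s \<in> I" using s \<open>cell_ideal c \<subseteq> I\<close> by blast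
        then have "g - s \<in> I" by (rule ideal.subspace_diff[OF I(1) g(1)])
        moreover have f: "g - s \<in> forms d" unfolding s_def
          by (intro poly2.subspace_diff poly2.subspace_sum poly2.subspace_scale forms_subspace basis_form_forms S_le g(2)[unfolded 3(2)])
        ultimately have nc: "initial_monomial (g - s) \<notin> cells P" using ne by (rule ini)
        have k: "initial_monomial (g - s) \<in> Poly_Mapping.keys (g - s)" by (rule initial_monomial_props(1)[OF ne])
        then have "deg (initial_monomial (g - s)) = d" using f unfolding forms_eq by blast
        define a where "a = snd (initial_monomial (g - s))"
        have ma: "initial_monomial (g - s) = (d - a, a)" "a \<le> d"
          using \<open>deg (initial_monomial (g - s)) = d\<close> by (auto simp: a_def prod_eq_iff)
        then have "a \<in> S" using nc by (simp add: S_def)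
        have "Poly_Mapping.lookup s (d - a, a) = (\<Sum>b\<in>S. if a = b then Poly_Mapping.lookup g (d - a, a) else 0)"
          unfolding s_def lookup_sum
          by (rule sum.cong) (use \<open>a \<in> S\<close> S_le in \<open>auto simp: lookup_basis_form\<close>)
        then have "Poly_Mapping.lookup (g - s) (d - a, a) = 0" using \<open>a \<in> S\<close> by (simp add: lookup_minus)
        then show False using k ma by (simp add: in_keys_iff)
      qed
      then show ?thesis using s by simp
    qed
  qed
  ultimately show ?thesis using that by blast
qed

lemma cell_ideal_cells_zero:
  assumes "f \<in> cell_ideal c" "Poly_Mapping.keys f \<subseteq> cells P"
  shows "f = 0"
proof -
  have "Poly_Mapping.lookup f (d - b, b) = 0" if "b \<in> S" for b
    using assms(2) that by (auto simp: S_def in_keys_iff)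
  then have "Poly_Mapping.keys f \<subseteq> {m. d < deg m}"
    using cell_ideal_decomp[OF assms(1)] by simp
  then have "Poly_Mapping.keys f = {}" using assms(2) high by blast
  then show ?thesis by simp
qed

lemma normal_form_eqI:
  assumes "Poly_Mapping.keys g \<subseteq> cells P" "monom2 m - g \<in> cell_ideal c"
  shows "normal_form P (cell_ideal c) m = g"
  unfolding normal_form_def
proof (rule the_equality)
  show "Poly_Mapping.keys g \<subseteq> cells P \<and> monom2 m - g \<in> cell_ideal c" using assms by blast
next
  fix g' assume g': "Poly_Mapping.keys g' \<subseteq> cells P \<and> monom2 m - g' \<in> cell_ideal c"
  have "(monom2 m - g) - (monom2 m - g') \<in> cell_ideal c"
    using g' by (intro ideal.subspace_diff[OF cell_ideal_ideal assms(2)]) blast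
  then have "g' - g \<in> cell_ideal c" by simp
  moreover have "Poly_Mapping.keys (g' - g) \<subseteq> cells P"
    using assms(1) g' keys_diff[of g' g] unfolding keys_subset_iff by (simp add: lookup_minus)
  ultimately have "g' - g = 0" by (rule cell_ideal_cells_zero)
  then show "g' = g" by simp
qed

lemma normal_form_basis:
  assumes "b \<in> S"
  shows "normal_form P (cell_ideal c) (d - b, b) = monom2 (d - b, b) - basis_form c b"
proof (rule normal_form_eqI)
  show "monom2 (d - b, b) - (monom2 (d - b, b) - basis_form c b) \<in> cell_ideal c"
    using basis_form_in[OF assms] by simp
  show "Poly_Mapping.keys (monom2 (d - b, b) - basis_form c b) \<subseteq> cells P"
    unfolding keys_subset_iff
  proof (intro allI impI)
    fix m assume m: "m \<notin> cells P"
    show "Poly_Mapping.lookup (monom2 (d - b, b) - basis_form c b) m = 0"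
    proof (cases "deg m = d")
      case True
      define a where "a = snd m"
      have ma: "m = (d - a, a)" "a \<in> S" using True m by (auto simp: a_def prod_eq_iff S_def)
      then show ?thesis using S_le[OF assms] by (auto simp: lookup_minus lookup_basis_form lookup_single when_def)
    next
      case False
      then show ?thesis using S_le[OF assms] by (auto simp: lookup_minus lookup_basis_form lookup_single when_def)
    qed
  qed
qed

section \<open>Density of basic open sets\<close>

text \<open>Along a line in the space of parameters every coordinate is affine, as it is constant or, up to sign,
  one of the parameters.\<close>

lemma coordinate_line:
  fixes c0 c1 :: "nat \<Rightarrow> nat \<Rightarrow> 'k::field"
  shows "\<exists>p. \<forall>z. coordinate P m n (cell_ideal (\<lambda>b a. c0 b a + z * (c1 b a - c0 b a))) = poly p z"
proof -
  let ?c = "\<lambda>z b a. c0 b a + z * (c1 b a - c0 b a)"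
  consider "m \<in> cells P" | "d < deg m" | b where "b \<in> S" "m = (d - b, b)"
  proof -
    assume 1: "m \<in> cells P \<Longrightarrow> thesis" and 2: "d < deg m \<Longrightarrow> thesis" and 3: "\<And>b. b \<in> S \<Longrightarrow> m = (d - b, b) \<Longrightarrow> thesis"
    show thesis
    proof (cases "m \<in> cells P \<or> d < deg m")
      case False
      then have "deg m = d" using low by (metis linorder_neqE_nat)
      then have "m = (d - snd m, snd m)" "snd m \<le> d" by (auto simp: prod_eq_iff)
      then show ?thesis using 3[of "snd m"] False by (auto simp: S_def)
    qed (use 1 2 in blast)
  qed
  then show ?thesis
  proof cases
    case 1
    have "normal_form P (cell_ideal (?c z)) m = monom2 m" for z
      by (rule normal_form_eqI) (use 1 ideal.subspace_0[OF cell_ideal_ideal] in auto)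
    then show ?thesis by (intro exI[of _ "[:Poly_Mapping.lookup (monom2 m) n:]"]) (simp add: coordinate_def)
  next
    case 2
    have "normal_form P (cell_ideal (?c z)) m = 0" for z
      by (rule normal_form_eqI) (use monom_in_cell_ideal[OF 2] in auto)
    then show ?thesis by (intro exI[of _ 0]) (simp add: coordinate_def)
  next
    case (3 b)
    let ?p = "[:Poly_Mapping.lookup (monom2 m) n:] - (if deg n \<noteq> d then 0 else if snd n = b then 1
      else if snd n < b \<and> snd n \<notin> S then [:c0 b (snd n), c1 b (snd n) - c0 b (snd n):] else 0)"
    show ?thesis
      unfolding coordinate_def 3(2) normal_form_basis[OF 3(1)] lookup_minus lookup_basis_form[OF S_le[OF 3(1)]]
      by (intro exI[of _ ?p]) (auto simp: 3(2))
  qed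
qed

lemma coordinate_ring_line:
  fixes c0 c1 :: "nat \<Rightarrow> nat \<Rightarrow> 'k::field"
  assumes "F \<in> coordinate_ring P"
  shows "\<exists>p. \<forall>z. F (cell_ideal (\<lambda>b a. c0 b a + z * (c1 b a - c0 b a))) = poly p z"
  using assms
proof induction
  case (const c)
  show ?case by (rule exI[of _ "[:c:]"]) simp
next
  case (coord m n)
  show ?case by (rule coordinate_line)
next
  case (add F G)
  then show ?case by (metis poly_add)
next
  case (mult F G)
  then show ?case by (metis poly_mult)
qed

text \<open>On the line that joins \<open>I\<close> and \<open>J\<close> both functions are nonzero polynomials, and over an infinite field
  their product has a nonroot.\<close>

lemma coordinate_ring_irreducible:
  fixes F G :: "'k::field poly2 set \<Rightarrow> 'k"
  assumes inf: "infinite (UNIV :: 'k set)" and FG: "F \<in> coordinate_ring P" "G \<in> coordinate_ring P"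
    and "I \<in> jordan_cell P" "F I \<noteq> 0" "J \<in> jordan_cell P" "G J \<noteq> 0"
  obtains K where "K \<in> jordan_cell P" "F K \<noteq> 0" "G K \<noteq> 0"
proof -
  obtain c0 c1 where c: "I = cell_ideal c0" "J = cell_ideal c1"
    using assms jordan_cell_cases by metis
  let ?K = "\<lambda>z. cell_ideal (\<lambda>b a. c0 b a + z * (c1 b a - c0 b a))"
  obtain p where p: "\<And>z. F (?K z) = poly p z" using coordinate_ring_line[OF FG(1)] by blast
  obtain q where q: "\<And>z. G (?K z) = poly q z" using coordinate_ring_line[OF FG(2)] by blast
  have "poly p 0 \<noteq> 0" "poly q 1 \<noteq> 0" using p[of 0] q[of 1] assms c by auto
  then have "p * q \<noteq> 0" by auto
  then have "finite {z. poly (p * q) z = 0}" by (rule poly_roots_finite)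
  then obtain z where "poly (p * q) z \<noteq> 0" using inf by (metis (mono_tags, lifting) UNIV_I ex_new_if_finite mem_Collect_eq)
  then have "F (?K z) \<noteq> 0" "G (?K z) \<noteq> 0" by (simp_all add: p q)
  then show ?thesis by (rule that[OF cell_ideal_in_cell])
qed

lemma zariski_open_contains_basic:
  fixes U :: "'k::field poly2 set set"
  assumes "openin (zariski P) U" "I \<in> U"
  shows "\<exists>F\<in>coordinate_ring P. F I \<noteq> 0 \<and> {I\<in>jordan_cell P. F I \<noteq> 0} \<subseteq> U"
proof -
  have "generate_topology_on ((\<lambda>F. {I \<in> jordan_cell P. F I \<noteq> 0}) ` coordinate_ring P) U"
    using assms(1) by (simp add: zariski_def openin_topology_generated_by_iff)
  then show ?thesis using assms(2)
  proof induction
    case (Int U V)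
    then obtain F G where F: "F \<in> coordinate_ring P" "F I \<noteq> 0" "{I\<in>jordan_cell P. F I \<noteq> 0} \<subseteq> U"
      and G: "G \<in> coordinate_ring P" "G I \<noteq> 0" "{I\<in>jordan_cell P. G I \<noteq> 0} \<subseteq> V" by blast
    then show ?case by (intro bexI[OF _ coordinate_ring.mult[OF F(1) G(1)]]) auto
  next
    case (UN K)
    then show ?case by (meson Union_iff Union_upper subset_trans)
  qed auto
qed

lemma generically_basic:
  fixes F :: "'k::field poly2 set \<Rightarrow> 'k"
  assumes inf: "infinite (UNIV :: 'k set)" and F: "F \<in> coordinate_ring P" "I0 \<in> jordan_cell P" "F I0 \<noteq> 0"
    and Q: "\<And>I :: 'k poly2 set. I \<in> jordan_cell P \<Longrightarrow> F I \<noteq> 0 \<Longrightarrow> Q I"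
  shows "generically P Q"
proof -
  let ?U = "{I \<in> jordan_cell P. F I \<noteq> 0}"
  have "openin (zariski P) ?U"
    unfolding zariski_def using F(1) by (intro topology_generated_by_Basis) blast
  moreover have "zariski P closure_of ?U = topspace (zariski P)"
  proof (rule equalityI[OF closure_of_subset_topspace], rule subsetI)
    fix J :: "'k poly2 set" assume J: "J \<in> topspace (zariski P)"
    show "J \<in> zariski P closure_of ?U"
      unfolding in_closure_of
    proof (intro conjI J allI impI)
      fix V assume "J \<in> V \<and> openin (zariski P) V"
      then obtain G where G: "G \<in> coordinate_ring P" "G J \<noteq> 0" "{I\<in>jordan_cell P. G I \<noteq> 0} \<subseteq> V"
        using zariski_open_contains_basic by blast
      obtain K where "K \<in> jordan_cell P" "F K \<noteq> 0" "G K \<noteq> 0"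
        using coordinate_ring_irreducible[OF inf F(1) G(1) F(2,3) _ G(2)] J by (auto simp: topspace_zariski)
      then show "\<exists>K. K \<in> ?U \<and> K \<in> V" using G(3) by blast
    qed
  qed
  ultimately show ?thesis using F Q unfolding generically_def by (intro exI[of _ ?U]) auto
qed

end

section \<open>Counting generators\<close>

abbreviation hmon :: "nat \<Rightarrow> nat \<Rightarrow> 'k::field poly2" where
  "hmon e i \<equiv> monom2 (e - i, i)"

definition restrict_keys :: "monomial set \<Rightarrow> 'k::field poly2 \<Rightarrow> 'k poly2" where
  "restrict_keys K f = (\<Sum>m\<in>K. Poly_Mapping.single m (Poly_Mapping.lookup f m))"

lemma lookup_restrict_keys:
  "finite K \<Longrightarrow> Poly_Mapping.lookup (restrict_keys K f) m = (if m \<in> K then Poly_Mapping.lookup f m else 0)"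
  by (simp add: restrict_keys_def lookup_sum lookup_single when_def)

lemma linear_restrict_keys:
  assumes "finite K"
  shows "Vector_Spaces.linear scale2 scale2 (restrict_keys K :: 'k::field poly2 \<Rightarrow> 'k poly2)"
  unfolding Vector_Spaces.linear_iff
  by (intro conjI allI poly2.vector_space_axioms poly_mapping_eqI)
    (simp_all add: lookup_restrict_keys[OF assms] lookup_add)

lemma spans_forms:
  fixes X :: "'k::field poly2 set"
  assumes "X \<subseteq> forms e" "poly2.independent X" "card X = Suc e" "finite X"
  shows "forms e \<subseteq> poly2.span X"
proof (rule ccontr)
  assume "\<not> forms e \<subseteq> poly2.span X"
  then obtain v where v: "v \<in> forms e" "v \<notin> poly2.span X" by blast
  have "v \<notin> X" using v(2) poly2.span_base by blast
  have "card (insert v X) \<le> card (monom2 ` {m. deg m = e} :: 'k poly2 set)"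
  proof (rule poly2.independent_span_bound[THEN conjunct2])
    show "poly2.independent (insert v X)" by (rule poly2.independent_insertI[OF v(2) assms(2)])
    show "insert v X \<subseteq> poly2.span (monom2 ` {m. deg m = e})"
      using v(1) assms(1) by (simp add: poly2_span_monom_eq forms_eq)
  qed (use finite_deg in auto)
  also have "\<dots> = Suc e" by (simp add: card_image[OF inj_monom2] card_deg)
  finally show False using \<open>v \<notin> X\<close> assms(3,4) by simp
qed

lemma hmon_span_forms: "forms e = poly2.span (hmon e ` {..e})"
proof -
  have "{m. deg m = e} = (\<lambda>i. (e - i, i)) ` {..e}" by (auto simp: image_iff)
  then show ?thesis
    unfolding forms_eq poly2_span_monom_eq[symmetric] by (simp add: image_image)
qed

lemma times_scale2: "r * scale2 c f = scale2 c (r * f)"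
  by (simp add: scale2_def mult.left_commute)

lemma card_Un_shift_le: "finite N \<Longrightarrow> card (u ` N \<union> v ` N) \<le> 2 * card N"
  using card_Un_le[of "u ` N" "v ` N"] card_image_le[of N u] card_image_le[of N v] by linarith

context top_degree_cell begin

definition products :: "(nat \<Rightarrow> nat \<Rightarrow> 'k::field) \<Rightarrow> nat set \<Rightarrow> 'k poly2 set" where
  "products c N = (\<lambda>b. monom2 (1, 0) * basis_form c b) ` N \<union> (\<lambda>b. monom2 (0, 1) * basis_form c b) ` N"

text \<open>The quotient of \<open>I\<close> by \<open>(x, y)I\<close>, in coordinates. A generator multiplied by \<open>r\<close> contributes, up to
  degree \<open>d + 1\<close>, its multiple by the constant term of \<open>r\<close> and an element of \<open>xV + yV\<close>. So \<open>G\<close> and a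
  spanning set \<open>B\<close> of \<open>xV + yV\<close> span the truncation of \<open>I\<close> to the degrees \<open>d\<close> and \<open>d + 1\<close>, of
  dimension \<open>|S| + d + 2\<close>.\<close>

lemma num_gens_lower_bound:
  fixes c :: "nat \<Rightarrow> nat \<Rightarrow> 'k::field"
  assumes G: "finite G" "ideal.span G = cell_ideal c" and B: "finite B" "products c S \<subseteq> poly2.span B"
  shows "card S + (d + 2) \<le> card G + card B"
proof -
  \<comment> \<open>Restricting to these coefficients is injective on the truncated ideal, and turns each basis form
    into its initial monomial.\<close>
  define K where "K = (\<lambda>b. (d - b, b)) ` S \<union> {m. deg m = Suc d}"
  have finK: "finite K" unfolding K_def using finite_deg finite_S by blast
  have degK: "deg m \<le> Suc d" if "m \<in> K" for m using that S_le by (auto simp: K_def)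
  let ?T = "restrict_keys K :: 'k poly2 \<Rightarrow> 'k poly2"
  note lin = linear_restrict_keys[OF finK, where 'k = 'k]
  note T_hom = lin[THEN Vector_Spaces.linear.axioms(3)]
  have span_T: "poly2.span (?T ` X) = ?T ` poly2.span X" for X
    by (rule module_hom.span_image[OF T_hom])
  let ?W = "poly2.span (?T ` (G \<union> B))"
  have TB: "?T f \<in> ?W" if "f \<in> poly2.span B" for f
    using that span_T[of "G \<union> B"] poly2.span_mono[of B "G \<union> B"] by blast
  have zero: "?T f = 0" if "\<And>m. deg m \<le> Suc d \<Longrightarrow> Poly_Mapping.lookup f m = 0" for f
    by (rule poly_mapping_eqI) (simp add: lookup_restrict_keys[OF finK] that degK)
  have G_sub: "G \<subseteq> cell_ideal c" using G(2) ideal.span_superset by blast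
  have step1: "?T (monom2 k * g) \<in> ?W" if g: "g \<in> G" for g k
  proof -
    have gc: "g \<in> cell_ideal c" using g G_sub by blast
    consider "k = 0" | "deg k = 1" | "2 \<le> deg k"
      by (cases k) (force simp: zero_prod_def)
    then show ?thesis
    proof cases
      case 1
      then show ?thesis using g by (auto intro: poly2.span_base)
    next
      case 2
      then have k: "k = (1, 0) \<or> k = (0, 1)" by (cases k) auto
      define s where "s = (\<Sum>b\<in>S. scale2 (Poly_Mapping.lookup g (d - b, b)) (basis_form c b))"
      have "monom2 k * basis_form c b \<in> poly2.span B" if "b \<in> S" for b
        using B(2) k that unfolding products_def by blast
      then have "monom2 k * s \<in> poly2.span B"
        unfolding s_def sum_distrib_left times_scale2 by (intro poly2.span_sum poly2.span_scale) blast
      moreover have "?T (monom2 k * (g - s)) = 0"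
      proof (rule zero)
        fix m assume "deg m \<le> Suc d"
        then have "fst k \<le> fst m \<and> snd k \<le> snd m \<Longrightarrow> \<not> d < deg (fst m - fst k, snd m - snd k)"
          using 2 by simp
        then show "Poly_Mapping.lookup (monom2 k * (g - s)) m = 0"
          using cell_ideal_decomp[OF gc] unfolding s_def keys_subset_iff by (simp add: lookup_single_mult)
      qed
      moreover have "?T (monom2 k * g) = ?T (monom2 k * s) + ?T (monom2 k * (g - s))"
        unfolding module_hom.add[OF T_hom, symmetric] distrib_left[symmetric] by simp
      ultimately show ?thesis using TB by simp
    next
      case 3
      have "?T (monom2 k * g) = 0"
      proof (rule zero)
        fix m assume "deg m \<le> Suc d"
        then have "fst k \<le> fst m \<and> snd k \<le> snd m \<Longrightarrow> deg (fst m - fst k, snd m - snd k) < d"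
          using 3 by (simp only: fst_conv snd_conv) linarith
        then show "Poly_Mapping.lookup (monom2 k * g) m = 0"
          using cell_idealD(1)[OF gc, of "(fst m - fst k, snd m - snd k)"] by (simp add: lookup_single_mult)
      qed
      then show ?thesis by (simp add: poly2.span_zero)
    qed
  qed
  have step2: "?T (r * g) \<in> ?W" if g: "g \<in> G" for g r
  proof -
    have "r * g = (\<Sum>k\<in>Poly_Mapping.keys r. Poly_Mapping.single k (Poly_Mapping.lookup r k)) * g"
      by (simp only: poly_mapping_sum_single)
    also have "\<dots> = (\<Sum>k\<in>Poly_Mapping.keys r. scale2 (Poly_Mapping.lookup r k) (monom2 k * g))"
      by (simp add: sum_distrib_right scale2_def mult_single flip: mult.assoc)
    finally have "?T (r * g) = (\<Sum>k\<in>Poly_Mapping.keys r. scale2 (Poly_Mapping.lookup r k) (?T (monom2 k * g)))"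
      by (simp add: module_hom.sum[OF T_hom] module_hom.scale[OF T_hom])
    also have "\<dots> \<in> ?W" by (intro poly2.span_sum poly2.span_scale step1 g)
    finally show ?thesis .
  qed
  have T_cell: "?T f \<in> ?W" if "f \<in> cell_ideal c" for f
  proof -
    have "f \<in> ideal.span G" using that G(2) by simp
    then show ?thesis
    proof (induction rule: ideal.span_induct_alt)
      case base
      then show ?case by (simp add: module_hom.zero[OF T_hom] poly2.span_zero)
    next
      case (step r g f)
      then show ?case using step2 by (simp add: module_hom.add[OF T_hom] poly2.span_add)
    qed
  qed
  have "monom2 ` K \<subseteq> ?W"
  proof (rule image_subsetI)
    fix m assume m: "m \<in> K"
    show "monom2 m \<in> ?W"
    proof (cases "deg m = Suc d")
      case True
      then have "?T (monom2 m) \<in> ?W" by (intro T_cell monom_in_cell_ideal) simp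
      moreover have "?T (monom2 m) = monom2 m"
        by (rule poly_mapping_eqI) (use m in \<open>auto simp: lookup_restrict_keys[OF finK] lookup_single when_def\<close>)
      ultimately show ?thesis by simp
    next
      case False
      then obtain b where b: "b \<in> S" "m = (d - b, b)" using m by (auto simp: K_def)
      have "?T (basis_form c b) \<in> ?W" by (intro T_cell basis_form_in b)
      moreover have "?T (basis_form c b) = monom2 m"
      proof (rule poly_mapping_eqI)
        fix n
        show "Poly_Mapping.lookup (?T (basis_form c b)) n = Poly_Mapping.lookup (monom2 m) n"
        proof (cases n)
          case (Pair i a)
          have "n \<in> K \<longleftrightarrow> i + a = d \<and> a \<in> S \<or> i + a = Suc d"
            unfolding K_def Pair using S_le by (auto simp: image_iff)
          then show ?thesis
            unfolding lookup_restrict_keys[OF finK] lookup_basis_form[OF S_le[OF b(1)]]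
            using S_le[OF b(1)] b Pair by (auto simp: lookup_single when_def)
        qed
      qed
      ultimately show ?thesis by simp
    qed
  qed
  then have "card (monom2 ` K :: 'k poly2 set) \<le> card (?T ` (G \<union> B))"
    using G(1) B(1) by (intro poly2.independent_span_bound[THEN conjunct2] independent_monom2) auto
  also have "\<dots> \<le> card G + card B"
    using card_image_le[of "G \<union> B" ?T] card_Un_le[of G B] G(1) B(1) by simp
  finally have "card K \<le> card G + card B" by (simp add: card_image[OF inj_monom2])
  moreover have "card K = card S + (d + 2)"
  proof -
    have "card K = card ((\<lambda>b. (d - b, b)) ` S) + card {m. deg m = Suc d}"
      unfolding K_def by (rule card_Un_disjoint) (use finite_deg S_le in auto)
    then show ?thesis by (simp add: card_deg card_image inj_on_def)
  qed
  ultimately show ?thesis by simp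
qed

lemma excess_eq:
  assumes "\<gamma> \<le> Suc d"
  shows "excess S d \<gamma> = int (Suc d - \<gamma>) - 2 * int (card (S \<inter> {\<gamma>..}))"
proof -
  have "card {\<gamma>..d} = card ({\<gamma>..d} - S) + card ({\<gamma>..d} \<inter> S)"
    by (metis card_Diff_subset_Int card_mono finite_Int finite_atLeastAtMost inf_le1 le_add_diff_inverse2)
  moreover have "{\<gamma>..d} \<inter> S = S \<inter> {\<gamma>..}" using S_le by auto
  ultimately show ?thesis using assms by (simp add: excess_def of_nat_diff)
qed

text \<open>Two kinds of spanning sets of \<open>xV + yV\<close>: all products, and, for \<open>\<gamma>\<close> where \<open>excess\<close> is maximal, the
  monomials of \<open>y\<close>-degree at most \<open>\<gamma>\<close> and the products of the basis forms of \<open>y\<close>-degree at least \<open>\<gamma>\<close>.\<close>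

lemma generators_ge:
  fixes c :: "nat \<Rightarrow> nat \<Rightarrow> 'k::field"
  assumes G: "finite G" "ideal.span G = cell_ideal c"
  shows "int (card S) + max (peak S d 0) (excess S d 0 + 1) \<le> int (card G)"
proof -
  have "card (products c S) \<le> 2 * card S" unfolding products_def by (rule card_Un_shift_le) simp
  moreover have "card S + (d + 2) \<le> card G + card (products c S)"
    by (rule num_gens_lower_bound[OF G]) (auto simp: products_def intro: poly2.span_base)
  ultimately have 1: "int (card S) + (excess S d 0 + 1) \<le> int (card G)"
    using excess_eq[of 0] by simp
  obtain \<gamma> where \<gamma>: "\<gamma> \<le> Suc d" "excess S d \<gamma> = peak S d 0" using peak_attained[of 0 d S] by auto
  let ?N = "S \<inter> {\<gamma>..}" and ?L = "hmon (Suc d) ` {..\<gamma>} :: 'k poly2 set"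
  let ?B = "?L \<union> products c ?N"
  have low_in: "monom2 k * basis_form c b \<in> poly2.span ?B" if b: "b \<in> S" "b < \<gamma>" and k: "k = (1, 0) \<or> k = (0, 1)" for b k
  proof -
    have "Poly_Mapping.keys (monom2 k * basis_form c b) \<subseteq> (\<lambda>i. (Suc d - i, i)) ` {..\<gamma>}"
    proof
      fix m assume "m \<in> Poly_Mapping.keys (monom2 k * basis_form c b)"
      then have "deg m = Suc d \<and> snd m \<le> \<gamma>"
        using S_le[OF b(1)] b(2) k
        by (auto simp: in_keys_iff lookup_single_mult lookup_basis_form split: if_splits)
      then show "m \<in> (\<lambda>i. (Suc d - i, i)) ` {..\<gamma>}" by (intro image_eqI[of _ _ "snd m"]) (auto simp: prod_eq_iff)
    qed
    from poly2_span_monom[OF this] show ?thesis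
      by (rule subsetD[OF poly2.span_mono, rotated]) (auto simp: image_image)
  qed
  have "products c S \<subseteq> poly2.span ?B"
  proof -
    have "monom2 k * basis_form c b \<in> poly2.span ?B" if b: "b \<in> S" and k: "k = (1, 0) \<or> k = (0, 1)" for b k
    proof (cases "b < \<gamma>")
      case False
      then have "monom2 k * basis_form c b \<in> ?B" using b k by (auto simp: products_def)
      then show ?thesis by (rule poly2.span_base)
    qed (use low_in b k in blast)
    then show ?thesis unfolding products_def by blast
  qed
  then have "card S + (d + 2) \<le> card G + card ?B"
    by (intro num_gens_lower_bound[OF G]) (auto simp: products_def)
  moreover have "card ?B \<le> Suc \<gamma> + 2 * card ?N"
  proof -
    have "card ?L \<le> Suc \<gamma>" using card_image_le[of "{..\<gamma>}" "hmon (Suc d) :: nat \<Rightarrow> 'k poly2"] by simp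
    moreover have "card (products c ?N) \<le> 2 * card ?N" unfolding products_def by (rule card_Un_shift_le) simp
    ultimately show ?thesis using card_Un_le[of ?L "products c ?N"] by linarith
  qed
  ultimately have "int (card S) + excess S d \<gamma> \<le> int (card G)"
    using excess_eq[OF \<gamma>(1)] \<gamma>(1) by (simp add: of_nat_diff)
  with 1 \<gamma>(2) show ?thesis by simp
qed

text \<open>The basis forms and the monomials indexed by \<open>A\<close> generate, because every monomial of degree above
  \<open>d + 1\<close> is a multiple of one of degree \<open>d + 1\<close>; by the lower bound there are no shorter systems.\<close>

lemma num_gens_eqI:
  fixes c :: "nat \<Rightarrow> nat \<Rightarrow> 'k::field"
  assumes A: "finite A" "int (card A) \<le> max (peak S d 0) (excess S d 0 + 1)"
    and sp: "forms (Suc d) \<subseteq> poly2.span (products c S \<union> hmon (Suc d) ` A)"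
    and A': "A \<subseteq> {..Suc d}"
  shows "int (num_gens (cell_ideal c)) = int (card S) + max (peak S d 0) (excess S d 0 + 1)"
proof -
  let ?G = "basis_form c ` S \<union> hmon (Suc d) ` A"
  have "ideal.span ?G \<subseteq> cell_ideal c"
    using basis_form_in A' by (intro ideal.span_minimal cell_ideal_ideal) (auto intro!: monom_in_cell_ideal)
  moreover have "cell_ideal c \<subseteq> ideal.span ?G"
  proof -
    have pr: "products c S \<subseteq> ideal.span ?G"
      unfolding products_def by (auto intro!: ideal.span_scale intro: ideal.span_base)
    have "poly2.span (products c S \<union> hmon (Suc d) ` A) \<subseteq> ideal.span ?G"
      using pr ideal.span_superset[of ?G] by (intro poly2_span_subset_ideal ideal.subspace_span) blast
    then have top: "monom2 m \<in> ideal.span ?G" if "deg m = Suc d" for m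
      using sp that unfolding forms_eq by fastforce
    have "monom2 m \<in> ideal.span ?G" if m: "d < deg m" for m
    proof -
      define i where "i = min (fst m) (Suc d)"
      define n where "n = (i, Suc d - i)"
      define k where "k = (fst m - i, snd m - (Suc d - i))"
      have "m = k + n" "deg n = Suc d" using m by (auto simp: i_def n_def k_def prod_eq_iff)
      then have "monom2 m = monom2 k * (monom2 n :: 'k poly2)" by (simp add: mult_single)
      then show ?thesis using ideal.span_scale[OF top[OF \<open>deg n = Suc d\<close>]] by simp
    qed
    then show ?thesis
      unfolding cell_ideal_span by (intro poly2_span_subset_ideal ideal.subspace_span) (auto intro: ideal.span_base)
  qed
  ultimately have gen: "ideal.span ?G = cell_ideal c" by blast
  have fin: "finite ?G" using A(1) by simp
  have "int (num_gens (cell_ideal c)) \<le> int (card ?G)"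
    unfolding num_gens_def using gen fin by (intro of_nat_mono Least_le) blast
  also have "\<dots> \<le> int (card S) + int (card A)"
    using card_Un_le[of "basis_form c ` S" "hmon (Suc d) ` A"] card_image_le[OF finite_S, of "basis_form c"]
      card_image_le[OF A(1), of "hmon (Suc d) :: nat \<Rightarrow> 'k poly2"] by linarith
  finally have "int (num_gens (cell_ideal c)) \<le> int (card S) + max (peak S d 0) (excess S d 0 + 1)" using A(2) by linarith
  moreover obtain G where "finite G" "card G = num_gens (cell_ideal c)" "ideal.span G = cell_ideal c"
    using LeastI_ex[of "\<lambda>n. \<exists>G. finite G \<and> card G = n \<and> ideal.span G = cell_ideal c"] gen fin
    unfolding num_gens_def by blast
  ultimately show ?thesis using generators_ge by fastforce
qed

definition homogenize :: "nat \<Rightarrow> 'k::field poly \<Rightarrow> 'k poly2" where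
  "homogenize e p = (\<Sum>i\<le>e. Poly_Mapping.single (e - i, i) (coeff p i))"

lemma lookup_homogenize: "Poly_Mapping.lookup (homogenize e p) m = (if deg m = e then coeff p (snd m) else 0)"
proof -
  have "Poly_Mapping.lookup (homogenize e p) m = (\<Sum>i\<le>e. if snd m = i then (if deg m = e then coeff p i else 0) else 0)"
    unfolding homogenize_def lookup_sum
    by (rule sum.cong) (auto simp: lookup_single when_def prod_eq_iff)
  also have "\<dots> = (if deg m = e then coeff p (snd m) else 0)"
    by (subst sum.delta') auto
  finally show ?thesis .
qed

text \<open>Homogenization of \<open>spread_family\<close> for \<open>\<beta> = 0\<close>: it carries the family and its shift to the products
  with \<open>x\<close> and \<open>y\<close>.\<close>

lemma special_spanning_ideal:
  assumes inf: "infinite (UNIV :: 'k::field set)"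
  obtains c :: "nat \<Rightarrow> nat \<Rightarrow> 'k::field" and A where "A \<subseteq> {..Suc d}" "int (card A) \<le> max (peak S d 0) (excess S d 0 + 1)"
    "forms (Suc d) \<subseteq> poly2.span (products c S \<union> hmon (Suc d) ` A)"
proof -
  have S0: "{0..d} \<inter> S = S" using S_le by auto
  obtain f :: "nat \<Rightarrow> 'k poly" and A where f: "\<And>b. b \<in> S \<Longrightarrow> monic_mod S 0 b (f b)"
    and A: "A \<subseteq> {0..Suc d}" "int (card A) \<le> peak S d 0"
    and sp: "\<And>i. i \<in> {0..Suc d} \<Longrightarrow> monom 1 i \<in> poly1.span (with_shift f S \<union> monom 1 ` insert 0 A)"
    and low: "excess S d 0 < peak S d 0 \<Longrightarrow> monom 1 0 \<in> poly1.span (with_shift f S)"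
    using spread_family[OF inf, of 0 d S] unfolding S0 by blast
  \<comment> \<open>The constant 1 is in \<open>V + yV\<close> unless \<open>excess\<close> is maximal at 0, which is when
    the bound \<open>excess 0 + 1\<close> admits one more element.\<close>
  define A' where "A' = (if excess S d 0 < peak S d 0 then A else insert 0 A)"
  have finA: "finite A" using A(1) finite_subset by blast
  have A': "A' \<subseteq> {..Suc d}" using A(1) by (auto simp: A'_def)
  have cardA': "int (card A') \<le> max (peak S d 0) (excess S d 0 + 1)"
    using A(2) finA by (auto simp: A'_def card_insert_if)
  have sp': "monom 1 i \<in> poly1.span (with_shift f S \<union> monom 1 ` A')" if i: "i \<le> Suc d" for i
  proof (cases "excess S d 0 < peak S d 0")
    case True
    have "monom 1 i \<in> poly1.span (with_shift f S \<union> monom 1 ` insert 0 A)" using sp i by simp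
    also have "\<dots> \<subseteq> poly1.span (with_shift f S \<union> monom 1 ` A)"
      using low[OF True] poly1.span_mono[of "with_shift f S" "with_shift f S \<union> monom 1 ` A"]
      by (intro poly1.span_minimal poly1.subspace_span) (auto intro: poly1.span_base)
    finally show ?thesis using True by (simp add: A'_def)
  qed (use sp[of i] i in \<open>simp add: A'_def\<close>)
  define c where "c b a = coeff (f b) a" for b a
  let ?h = "homogenize (Suc d) :: 'k poly \<Rightarrow> 'k poly2"
  have lin: "Vector_Spaces.linear smult scale2 ?h"
    unfolding Vector_Spaces.linear_iff
    by (intro conjI allI poly2.vector_space_axioms poly1.vector_space_axioms poly_mapping_eqI)
      (simp_all add: lookup_homogenize lookup_add)
  have h1: "?h (f b) = monom2 (1, 0) * basis_form c b" if b: "b \<in> S" for b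
  proof (rule poly_mapping_eqI)
    fix m
    show "Poly_Mapping.lookup (?h (f b)) m = Poly_Mapping.lookup (monom2 (1, 0) * basis_form c b) m"
      using f[OF b] S_le[OF b] by (auto simp: lookup_homogenize lookup_single_mult lookup_basis_form c_def monic_mod_def)
  qed
  have h2: "?h (pCons 0 (f b)) = monom2 (0, 1) * basis_form c b" if b: "b \<in> S" for b
  proof (rule poly_mapping_eqI)
    fix m
    show "Poly_Mapping.lookup (?h (pCons 0 (f b))) m = Poly_Mapping.lookup (monom2 (0, 1) * basis_form c b) m"
      using f[OF b] S_le[OF b]
      by (auto simp: lookup_homogenize lookup_single_mult lookup_basis_form c_def monic_mod_def coeff_pCons split: nat.splits)
  qed
  have h3: "?h (monom 1 i) = hmon (Suc d) i" if "i \<le> Suc d" for i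
    by (rule poly_mapping_eqI) (use that in \<open>auto simp: lookup_homogenize lookup_single when_def prod_eq_iff\<close>)
  have "?h ` (with_shift f S \<union> monom 1 ` A') = products c S \<union> hmon (Suc d) ` A'"
    using h1 h2 h3 A' unfolding with_shift_def products_def image_Un image_image
    by (intro arg_cong2[where f = "(\<union>)"] image_cong) auto
  then have span_img: "?h ` poly1.span (with_shift f S \<union> monom 1 ` A') = poly2.span (products c S \<union> hmon (Suc d) ` A')"
    using module_hom.span_image[OF lin[THEN Vector_Spaces.linear.axioms(3)]] by metis
  have "hmon (Suc d) ` {..Suc d} \<subseteq> poly2.span (products c S \<union> hmon (Suc d) ` A')"
  proof (rule image_subsetI)
    fix i assume "i \<in> {..Suc d}"
    then have i: "i \<le> Suc d" by simp
    show "hmon (Suc d) i \<in> poly2.span (products c S \<union> hmon (Suc d) ` A')"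
      unfolding span_img[symmetric] h3[OF i, symmetric] by (rule imageI[OF sp'[OF i]])
  qed
  then have "forms (Suc d) \<subseteq> poly2.span (products c S \<union> hmon (Suc d) ` A')"
    unfolding hmon_span_forms by (intro poly2.span_minimal poly2.subspace_span)
  then show ?thesis using that A' cardA' by blast
qed

text \<open>In the special ideal choose a basis \<open>B\<close> of \<open>R\<^bsub>d+1\<^esub>\<close> among the products and the complementary
  monomials. The same choice of products in another ideal of the cell has entries in the coordinate
  ring, so it stays independent, and by dimension a basis, on a basic open set.\<close>

lemma generic_num_gens:
  assumes inf: "infinite (UNIV :: 'k::field set)"
  shows "generically P (\<lambda>I :: 'k poly2 set. int (num_gens I) = int (card S) + max (peak S d 0) (excess S d 0 + 1))"
proof -
  obtain c0 :: "nat \<Rightarrow> nat \<Rightarrow> 'k" and A where A: "A \<subseteq> {..Suc d}" "int (card A) \<le> max (peak S d 0) (excess S d 0 + 1)"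
    and sp: "forms (Suc d) \<subseteq> poly2.span (products c0 S \<union> hmon (Suc d) ` A)"
    using special_spanning_ideal[OF inf] .
  have finA: "finite A" using A(1) finite_subset by blast
  let ?X = "\<lambda>c. products c S \<union> hmon (Suc d) ` A"
  have X_forms: "?X c \<subseteq> forms (Suc d)" for c :: "nat \<Rightarrow> nat \<Rightarrow> 'k"
  proof -
    have "monom2 k * basis_form c b \<in> forms (Suc d)" if "b \<in> S" "deg k = 1" for b k
      using S_le[OF that(1)] that(2)
      by (auto simp: forms_eq in_keys_iff lookup_single_mult lookup_basis_form split: if_splits)
    moreover have "hmon (Suc d) i \<in> forms (Suc d)" if "i \<in> A" for i using that A(1) by (auto simp: forms_eq)
    ultimately show ?thesis unfolding products_def by force
  qed
  have "finite (?X c0)" using finA by (auto simp: products_def)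
  obtain B where B: "B \<subseteq> ?X c0" "poly2.independent B" "?X c0 \<subseteq> poly2.span B"
    using poly2.maximal_independent_subset[of "?X c0"] .
  have finB: "finite B" using B(1) \<open>finite (?X c0)\<close> finite_subset by blast
  have "forms (Suc d) \<subseteq> poly2.span B"
    using sp poly2.span_minimal[OF B(3) poly2.subspace_span] by blast
  then have "card B = poly2.dim (forms (Suc d) :: 'k poly2 set)"
    using B(1,2) X_forms[of c0] by (intro poly2.basis_card_eq_dim) (blast intro: order_trans)+
  then have cardB: "card B = Suc (Suc d)"
    by (simp add: forms_eq dim_keys_subset[OF finite_deg] card_deg)
  \<comment> \<open>\<open>\<phi> I\<close> is the vector of the ideal \<open>I\<close> that corresponds to the basis vector \<open>u\<close>. A basis form
    is a monomial minus its normal form, so the coefficients of \<open>\<phi> I\<close> are coordinate functions.\<close>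
  have "\<exists>\<phi>. \<phi> (cell_ideal c0) = u \<and> (\<forall>n. (\<lambda>I. Poly_Mapping.lookup (\<phi> I) n) \<in> coordinate_ring P) \<and> (\<forall>c. \<phi> (cell_ideal c) \<in> ?X c)"
    if u: "u \<in> B" for u
  proof -
    from u B(1) consider b k where "b \<in> S" "k = (1, 0) \<or> k = (0, 1)" "u = monom2 k * basis_form c0 b"
      | i where "i \<in> A" "u = hmon (Suc d) i" unfolding products_def by blast
    then show ?thesis
    proof cases
      case (1 b k)
      let ?\<phi> = "\<lambda>I. monom2 k * (hmon d b - normal_form P I (d - b, b))"
      have val: "?\<phi> (cell_ideal c) = monom2 k * basis_form c b" for c :: "nat \<Rightarrow> nat \<Rightarrow> 'k"
        by (simp add: normal_form_basis[OF 1(1)])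
      have "(\<lambda>I. Poly_Mapping.lookup (?\<phi> I) n) \<in> coordinate_ring P" for n
      proof (cases "fst k \<le> fst n \<and> snd k \<le> snd n")
        case True
        let ?n = "(fst n - fst k, snd n - snd k)"
        have "(\<lambda>I. Poly_Mapping.lookup (hmon d b) ?n + (-1) * coordinate P (d - b, b) ?n I) \<in> coordinate_ring P"
          by (intro coordinate_ring.intros)
        then show ?thesis using True by (simp add: lookup_single_mult lookup_minus coordinate_def)
      next
        case False
        then have eq: "(\<lambda>I. Poly_Mapping.lookup (?\<phi> I) n) = (\<lambda>_. 0)"
          unfolding lookup_single_mult by (simp only: if_False)
        show ?thesis unfolding eq by (rule coordinate_ring.const)
      qed
      moreover have "?\<phi> (cell_ideal c) \<in> ?X c" for c :: "nat \<Rightarrow> nat \<Rightarrow> 'k"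
        unfolding val products_def using 1 by blast
      ultimately show ?thesis using 1(3) val by (intro exI[of _ ?\<phi>]) blast
    next
      case (2 i)
      then show ?thesis by (intro exI[of _ "\<lambda>_. hmon (Suc d) i"]) (auto intro: coordinate_ring.const)
    qed
  qed
  then have "\<forall>u\<in>B. \<exists>\<phi>. \<phi> (cell_ideal c0) = u \<and> (\<forall>n. (\<lambda>I. Poly_Mapping.lookup (\<phi> I) n) \<in> coordinate_ring P) \<and>
      (\<forall>c. \<phi> (cell_ideal c) \<in> ?X c)" by (rule ballI)
  from bchoice[OF this] obtain \<phi> where \<phi>': "\<forall>u\<in>B. \<phi> u (cell_ideal c0) = u \<and>
      (\<forall>n. (\<lambda>I. Poly_Mapping.lookup (\<phi> u I) n) \<in> coordinate_ring P) \<and> (\<forall>c. \<phi> u (cell_ideal c) \<in> ?X c)" ..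
  have \<phi>: "\<phi> u (cell_ideal c0) = u" "(\<lambda>I. Poly_Mapping.lookup (\<phi> u I) n) \<in> coordinate_ring P"
    "\<phi> u (cell_ideal c) \<in> ?X c" if "u \<in> B" for u n c
    using bspec[OF \<phi>' that] by blast+
  have look: "Poly_Mapping.lookup (\<Sum>u\<in>B. scale2 (a u) (v u)) n = (\<Sum>u\<in>B. a u * Poly_Mapping.lookup (v u) n)"
    for a and v :: "'k poly2 \<Rightarrow> 'k poly2" and n
    by (simp add: lookup_sum)
  have ind0: "\<forall>u\<in>B. a u = 0" if "\<And>n. (\<Sum>u\<in>B. a u * Poly_Mapping.lookup (\<phi> u (cell_ideal c0)) n) = 0" for a
  proof -
    have "(\<Sum>u\<in>B. scale2 (a u) u) = 0"
      by (rule poly_mapping_eqI) (use that in \<open>simp add: lookup_sum \<phi>(1)\<close>)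
    then show ?thesis using poly2.independentD[OF B(2) finB order_refl] by blast
  qed
  obtain F where F: "F \<in> coordinate_ring P" "F (cell_ideal c0) \<noteq> 0"
    "\<And>I a. F I \<noteq> 0 \<Longrightarrow> (\<And>n. (\<Sum>u\<in>B. a u * Poly_Mapping.lookup (\<phi> u I) n) = 0) \<Longrightarrow> \<forall>u\<in>B. a u = 0"
    using indep_family_generic[where M = "\<lambda>u n I. Poly_Mapping.lookup (\<phi> u I) n" and K = B
        and A = "coordinate_ring P" and p = "cell_ideal c0",
        OF coordinate_ring.const coordinate_ring.add coordinate_ring.mult finB \<phi>(2) ind0] by blast
  show ?thesis
  proof (rule generically_basic[OF inf F(1) cell_ideal_in_cell F(2)])
    fix I :: "'k poly2 set" assume I: "I \<in> jordan_cell P" "F I \<noteq> 0"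
    obtain c where c: "I = cell_ideal c" using jordan_cell_cases[OF I(1)] .
    let ?v = "\<lambda>u. \<phi> u I"
    have fam: "poly2.indep_family B ?v"
      unfolding poly2.indep_family_def
    proof (intro allI impI)
      fix a assume a: "(\<Sum>u\<in>B. scale2 (a u) (?v u)) = 0"
      show "\<forall>u\<in>B. a u = 0"
        by (rule F(3)[OF I(2)]) (simp add: look[symmetric] a)
    qed
    have v_X: "?v ` B \<subseteq> ?X c" using \<phi>(3) c by blast
    have "forms (Suc d) \<subseteq> poly2.span (?v ` B)"
    proof (rule spans_forms)
      show "?v ` B \<subseteq> forms (Suc d)" using v_X X_forms by blast
      show "poly2.independent (?v ` B)" by (rule poly2.indep_family_independent[OF finB fam])
      show "card (?v ` B) = Suc (Suc d)"
        by (simp add: card_image[OF poly2.indep_family_inj_on[OF finB fam]] cardB)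
    qed (use finB in simp)
    also have "\<dots> \<subseteq> poly2.span (?X c)" by (rule poly2.span_mono[OF v_X])
    finally show "int (num_gens I) = int (card S) + max (peak S d 0) (excess S d 0 + 1)"
      unfolding c by (rule num_gens_eqI[OF finA A(2) _ A(1)])
  qed
qed

lemma kappa_eq:
  assumes "infinite (UNIV :: 'k::field set)"
  shows "int (kappa TYPE('k) P) = int (card S) + max (peak S d 0) (excess S d 0 + 1)"
proof -
  let ?N = "nat (int (card S) + max (peak S d 0) (excess S d 0 + 1))"
  have "0 \<le> peak S d 0" using excess_le_peak[of 0 "Suc d" d S] by simp
  then have N: "int n = int (card S) + max (peak S d 0) (excess S d 0 + 1) \<longleftrightarrow> n = ?N" for n by linarith
  have "kappa TYPE('k) P = ?N"
    using generic_num_gens[OF assms] unfolding N by (rule kappa_eqI)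
  then show ?thesis using N by blast
qed

end

section \<open>Hook codes\<close>

lemma partition_not_cells_upward:
  assumes "is_partition P" "m \<notin> cells P"
  shows "k + m \<notin> cells P"
proof
  assume a: "k + m \<in> cells P"
  obtain i a' where m: "m = (i, a')" by (cases m)
  obtain i' b' where k: "k = (i', b')" by (cases k)
  from a have b: "b' + a' < length P" "i' + i < P ! (b' + a')" by (auto simp: m k cells_def)
  have "P ! (b' + a') \<le> P ! a'"
    using assms(1) b(1) sorted_wrt_nth_less[of "(\<ge>)" P a' "b' + a'"]
    by (cases "b' = 0") (auto simp: is_partition_def)
  then have "m \<in> cells P" using b by (simp add: m cells_def)
  then show False using assms(2) by blast
qed

lemma diagonal_lengths_eq:
  assumes "is_partition P"
  shows "diagonal_lengths TYPE('k::field) P i = card ({m. deg m = i} \<inter> cells P)"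
proof -
  have "hilbert_function (ideal.span (monom2 ` (- cells P)) :: 'k poly2 set) i = card ({m. deg m = i} - - cells P)"
    by (rule hilbert_function_monomial) (use partition_not_cells_upward[OF assms] in auto)
  then show ?thesis by (simp add: diagonal_lengths_def E_ideal_def Diff_eq)
qed

lemma length_blocks: "length (concat (map (\<lambda>i. replicate (l i) (h i)) [1..<Suc n])) = (\<Sum>i=1..n. l i)"
  by (induction n) auto

lemma nth_block_start:
  assumes "k \<in> {1..n}" "1 \<le> l k"
  shows "concat (map (\<lambda>i. replicate (l i) (h i)) [1..<Suc n]) ! (\<Sum>i\<in>{1..<k}. l i) = h k"
  using assms(1)
proof (induction n)
  case (Suc n)
  let ?L = "concat (map (\<lambda>i. replicate (l i) (h i)) [1..<Suc n])"
  have split: "concat (map (\<lambda>i. replicate (l i) (h i)) [1..<Suc (Suc n)]) = ?L @ replicate (l (Suc n)) (h (Suc n))" by simp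
  show ?case
  proof (cases "k = Suc n")
    case True
    have "(\<Sum>i\<in>{1..<k}. l i) = length ?L" unfolding length_blocks True by (simp add: atLeastLessThanSuc_atLeastAtMost)
    then show ?thesis unfolding split using assms(2) True by (simp only: nth_append_length_plus[where n = 0, simplified] nth_append less_irrefl if_False diff_self_eq_0) simp
  next
    case False
    then have k: "k \<in> {1..n}" using Suc.prems by auto
    have "(\<Sum>i\<in>{1..<k}. l i) + l k = (\<Sum>i\<in>{1..<Suc k}. l i)" using k by simp
    also have "\<dots> \<le> (\<Sum>i=1..n. l i)" by (rule sum_mono2) (use k in auto)
    finally have "(\<Sum>i\<in>{1..<k}. l i) < length ?L" unfolding length_blocks using assms(2) by linarith
    then show ?thesis unfolding split using Suc.IH[OF k] by (simp only: nth_append if_True)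
  qed
qed simp

lemma nth_block_ex:
  assumes "j < (\<Sum>i=1..n. l i)"
  shows "\<exists>k\<in>{1..n}. (\<Sum>i\<in>{1..<k}. l i) \<le> j \<and> concat (map (\<lambda>i. replicate (l i) (h i)) [1..<Suc n]) ! j = h k"
  using assms
proof (induction n)
  case (Suc n)
  let ?L = "concat (map (\<lambda>i. replicate (l i) (h i)) [1..<Suc n])"
  have split: "concat (map (\<lambda>i. replicate (l i) (h i)) [1..<Suc (Suc n)]) = ?L @ replicate (l (Suc n)) (h (Suc n))" by simp
  show ?case
  proof (cases "j < (\<Sum>i=1..n. l i)")
    case True
    then obtain k where "k \<in> {1..n}" "(\<Sum>i\<in>{1..<k}. l i) \<le> j" "?L ! j = h k" using Suc.IH by blast
    moreover have "j < length ?L" unfolding length_blocks by (rule True)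
    ultimately show ?thesis unfolding split by (intro bexI[of _ k]) (auto simp only: nth_append if_True atLeastAtMost_iff)
  next
    case False
    then have "\<not> j < length ?L" unfolding length_blocks .
    moreover have "j - length ?L < l (Suc n)" using Suc.prems False unfolding length_blocks by simp
    then have "replicate (l (Suc n)) (h (Suc n)) ! (j - length ?L) = h (Suc n)" by (rule List.nth_replicate)
    ultimately have "(?L @ replicate (l (Suc n)) (h (Suc n))) ! j = h (Suc n)" by (simp only: nth_append if_False)
    then show ?thesis unfolding split using False
      by (intro bexI[of _ "Suc n"]) (simp_all add: atLeastLessThanSuc_atLeastAtMost)
  qed
qed simp

lemma concat_if_filter: "concat (map (\<lambda>b. if Q b then [g b] else []) xs) = map g (filter Q xs)"
  by (induction xs) auto

context top_degree_cell begin

text \<open>A hook with hand \<open>x\<^bsup>d-b\<^esup>y\<^bsup>b\<^esup>\<close> and arm \<open>u = v + 1\<close> has corner \<open>x\<^bsup>d-b-v\<^esup>y\<^bsup>b\<^esup>\<close>, so its leg ends below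
  \<open>x\<^bsup>d-b-v\<^esup>y\<^bsup>b+v\<^esup>\<close>, a monomial of degree \<open>d\<close>. It is a hook if and only if that monomial is not a cell,
  which means \<open>b + v \<in> S\<close>.\<close>

lemma num_diff_one_hooks_eq:
  assumes b: "b \<le> d" "b \<notin> S"
  shows "num_diff_one_hooks P (d - b, b) = card (S \<inter> {b<..})"
proof -
  let ?H = "{(c, u, v). is_hook P c u v \<and> hook_hand c u = (d - b, b) \<and> int u - int v = 1}"
  let ?f = "\<lambda>b'. ((d - b', b), Suc (b' - b), b' - b)"
  have "bij_betw ?f (S \<inter> {b<..}) ?H"
  proof (rule bij_betwI[where g = "\<lambda>(c, u, v). b + v"])
    show "?f \<in> S \<inter> {b<..} \<rightarrow> ?H"
    proof
      fix b' assume "b' \<in> S \<inter> {b<..}"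
      then have b': "b' \<in> S" "b < b'" "b' \<le> d" using S_le by auto
      have bc: "(d - b, b) \<in> cells P" using b by (simp add: S_def)
      have arm: "(d - b' + i, b) \<in> cells P" if "i < Suc (b' - b)" for i
      proof (cases "i = b' - b")
        case True
        then have "d - b' + i = d - b" using b' by simp
        then show ?thesis using bc by simp
      qed (use that b' in \<open>intro low, simp\<close>)
      have "is_hook P (d - b', b) (Suc (b' - b)) (b' - b)"
        unfolding is_hook_def
      proof (intro conjI allI impI)
        show "(d - b', b) + (i, 0) \<in> cells P" if "i < Suc (b' - b)" for i using arm[OF that] by simp
        show "(d - b', b) + (Suc (b' - b), 0) \<notin> cells P" by (rule high) (use b' in simp)
        show "(d - b', b) + (0, j) \<in> cells P" if "j < b' - b" for j by (rule low) (use that b' in simp)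
        show "(d - b', b) + (0, b' - b) \<notin> cells P" using b' by (simp add: S_def)
      qed (use b' in auto)
      moreover have "hook_hand (d - b', b) (Suc (b' - b)) = (d - b, b)" using b' by (simp add: hook_hand_def)
      ultimately show "?f b' \<in> ?H" by simp
    qed
    have inv: "b + v \<in> S \<inter> {b<..} \<and> ?f (b + v) = (c, u, v)" if "(c, u, v) \<in> ?H" for c u v
    proof -
      from that have hk: "is_hook P c u v" "hook_hand c u = (d - b, b)" "u = Suc v" by auto
      obtain i a where c: "c = (i, a)" by (cases c)
      have ia: "i + v = d - b" "a = b" using hk(2,3) by (auto simp: hook_hand_def c)
      have "1 \<le> v" "(i, b + v) \<notin> cells P" using hk(1) ia(2) by (auto simp: is_hook_def c)
      moreover have "i = d - (b + v)" "b + v \<le> d" using ia(1) b(1) calculation(1) by auto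
      ultimately show ?thesis using hk(3) ia(2) by (simp add: S_def c)
    qed
    show "(\<lambda>(c, u, v). b + v) \<in> ?H \<rightarrow> S \<inter> {b<..}"
    proof
      fix y assume "y \<in> ?H"
      then show "(\<lambda>(c, u, v). b + v) y \<in> S \<inter> {b<..}" using inv by (cases y) (simp only: prod.case)
    qed
    show "(\<lambda>(c, u, v). b + v) (?f x) = x" if "x \<in> S \<inter> {b<..}" for x using that by simp
    show "?f ((\<lambda>(c, u, v). b + v) y) = y" if "y \<in> ?H" for y
      using inv that by (cases y) (simp only: prod.case)
  qed
  then show ?thesis unfolding num_diff_one_hooks_def by (rule bij_betw_same_card[symmetric])
qed

text \<open>The \<open>y\<close>-degrees of the monomials of degree \<open>d\<close> in \<open>cells P\<close>, in increasing order: the hook code lists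
  their hook numbers.\<close>

definition hands :: "nat list" where "hands = filter (\<lambda>b. b \<notin> S) [0..<Suc d]"

lemma hook_code_eq: "hook_code d P = map (\<lambda>b. card (S \<inter> {b<..})) hands"
proof -
  have "hook_code d P = map (\<lambda>b. num_diff_one_hooks P (d - b, b)) (filter (\<lambda>b. (d - b, b) \<in> cells P) [0..<Suc d])"
    unfolding hook_code_def by (rule concat_if_filter)
  also have "filter (\<lambda>b. (d - b, b) \<in> cells P) [0..<Suc d] = hands"
    unfolding hands_def by (rule filter_cong) (auto simp: S_def)
  also have "map (\<lambda>b. num_diff_one_hooks P (d - b, b)) hands = map (\<lambda>b. card (S \<inter> {b<..})) hands"
    by (rule map_cong) (auto simp: hands_def num_diff_one_hooks_eq less_Suc_eq_le simp del: upt_Suc)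
  finally show ?thesis .
qed

lemma set_hands: "set hands = {..d} - S"
  by (auto simp: hands_def less_Suc_eq_le simp del: upt_Suc)

text \<open>From the \<open>j\<close>-th hand on there are \<open>length hands - j\<close> hands, and the elements of \<open>S\<close> above it are counted
  by the hook code.\<close>

lemma excess_hand:
  assumes j: "j < length hands"
  shows "excess S d (hands ! j) = int (length hands) - int j - int (hook_code d P ! j)"
proof -
  let ?g = "hands ! j"
  have sorted: "sorted_wrt (<) hands" unfolding hands_def by (intro sorted_wrt_filter sorted_wrt_upt)
  have g: "?g \<in> {..d} - S" using nth_mem[OF j] unfolding set_hands .
  have "{?g..d} - S = set (drop j hands)"
  proof
    show "set (drop j hands) \<subseteq> {?g..d} - S"
    proof
      fix x assume x: "x \<in> set (drop j hands)"
      then obtain i where i: "i < length hands - j" "x = hands ! (j + i)" by (auto simp: in_set_conv_nth)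
      have "?g \<le> x" using sorted_wrt_nth_less[OF sorted, of j "j + i"] i by (cases "i = 0") (auto simp: less_diff_conv add.commute)
      then show "x \<in> {?g..d} - S" using x in_set_dropD[OF x] unfolding set_hands by simp
    qed
    show "{?g..d} - S \<subseteq> set (drop j hands)"
    proof
      fix x assume x: "x \<in> {?g..d} - S"
      then have "x \<in> set hands" unfolding set_hands by simp
      then obtain i where i: "i < length hands" "x = hands ! i" by (auto simp: in_set_conv_nth)
      have "j \<le> i" using sorted_wrt_nth_less[OF sorted, of i j] j i x by (simp add: linorder_not_less[symmetric]) (metis less_irrefl linorder_not_less)
      then show "x \<in> set (drop j hands)" using i by (auto simp: in_set_conv_nth intro!: exI[of _ "i - j"])
    qed
  qed
  moreover have "card (set (drop j hands)) = length hands - j"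
    by (subst distinct_card) (simp_all add: hands_def del: upt_Suc)
  moreover have "{?g..d} \<inter> S = S \<inter> {?g<..}" using g by (auto dest: S_le intro: le_neq_trans)
  ultimately show ?thesis using j by (simp add: excess_def hook_code_eq of_nat_diff)
qed

text \<open>At the start of a block \<open>excess\<close> is \<open>\<tau>\<^sub>k\<close>. Elsewhere it is not larger than
  at some such start: moving up from \<open>\<gamma>\<close> to the next hand
  skips only elements of \<open>S\<close>, and moving down from a hand to the start of its block adds hands while
  the hook number, the same in the whole block, keeps the count in \<open>S\<close>. Above all hands it is at
  most \<open>0\<close>.\<close>

lemma max_excess_eq:
  fixes \<tau> :: "nat \<Rightarrow> int"
  assumes code: "hook_code d P = concat (map (\<lambda>i. replicate (l i) (h i)) [1..<Suc n])"
    and l: "\<And>i. 1 \<le> i \<Longrightarrow> i \<le> n \<Longrightarrow> 1 \<le> l i"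
    and \<tau>: "\<And>k. 1 \<le> k \<Longrightarrow> k \<le> n \<Longrightarrow> \<tau> k = (\<Sum>i = k..n. int (l i)) - int (h k)"
  shows "Max ({excess S d 0 + 1, 0} \<union> \<tau> ` {1..n}) = max (peak S d 0) (excess S d 0 + 1)"
proof -
  have len: "length hands = (\<Sum>i=1..n. l i)"
    using arg_cong[OF code, of length] unfolding length_blocks by (simp add: hook_code_eq)
  have \<tau>': "\<tau> k = int (length hands) - int (\<Sum>i\<in>{1..<k}. l i) - int (h k)" if k: "k \<in> {1..n}" for k
  proof -
    have "(\<Sum>i=1..n. l i) = (\<Sum>i\<in>{1..<k}. l i) + (\<Sum>i=k..n. l i)"
      using sum.atLeastLessThan_concat[of 1 k "Suc n" l] k by (simp add: atLeastLessThanSuc_atLeastAtMost)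
    then show ?thesis using \<tau>[of k] k unfolding len by simp
  qed
  have \<tau>_excess: "\<tau> k \<le> peak S d 0" if k: "k \<in> {1..n}" for k
  proof -
    let ?j = "\<Sum>i\<in>{1..<k}. l i"
    have "?j + l k = (\<Sum>i\<in>{1..<Suc k}. l i)" using k by simp
    also have "\<dots> \<le> (\<Sum>i=1..n. l i)" by (rule sum_mono2) (use k in auto)
    finally have j: "?j < length hands" unfolding len using l[of k] k by simp
    have "\<tau> k = excess S d (hands ! ?j)"
      unfolding \<tau>'[OF k] excess_hand[OF j] code using nth_block_start[OF k, of l h] l[of k] k by simp
    also have "\<dots> \<le> peak S d 0"
      using nth_mem[OF j] unfolding set_hands by (intro excess_le_peak) auto
    finally show ?thesis .
  qed
  have "0 \<le> peak S d 0" using excess_le_peak[of 0 "Suc d" d S] by simp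
  let ?M = "{excess S d 0 + 1, 0} \<union> \<tau> ` {1..n}"
  have fin: "finite ?M" by simp
  have "peak S d 0 \<le> Max ?M"
  proof -
    obtain \<gamma> where \<gamma>: "\<gamma> \<le> Suc d" "excess S d \<gamma> = peak S d 0" using peak_attained[of 0 d S] by auto
    show ?thesis
    proof (cases "{\<gamma>..d} - S = {}")
      case True
      then have "excess S d \<gamma> \<le> 0" unfolding excess_def by (simp only: card.empty)
      also have "0 \<le> Max ?M" using fin by (intro Max_ge) auto
      finally show ?thesis using \<gamma> by simp
    next
      case False
      define b where "b = Min ({\<gamma>..d} - S)"
      have b: "b \<in> {\<gamma>..d} - S" unfolding b_def using False by (intro Min_in) auto
      have "{b..d} - S = {\<gamma>..d} - S"
      proof (rule antisym)
        show "{\<gamma>..d} - S \<subseteq> {b..d} - S" unfolding b_def by (auto intro: Min_le)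
      qed (use b in auto)
      moreover have "card ({b..d} \<inter> S) \<le> card ({\<gamma>..d} \<inter> S)" using b by (intro card_mono) auto
      ultimately have le: "excess S d \<gamma> \<le> excess S d b" by (simp add: excess_def)
      have "b \<in> set hands" using b unfolding set_hands by simp
      then obtain j where j: "j < length hands" "b = hands ! j" by (auto simp: in_set_conv_nth)
      obtain k where k: "k \<in> {1..n}" "(\<Sum>i\<in>{1..<k}. l i) \<le> j" "hook_code d P ! j = h k"
        using nth_block_ex[of j l n h] j(1) unfolding len code by blast
      have "excess S d b \<le> \<tau> k" unfolding j(2) excess_hand[OF j(1)] k(3) \<tau>'[OF k(1)] using k(2) by linarith
      also have "\<dots> \<le> Max ?M" using fin k(1) by (intro Max_ge) auto
      finally show ?thesis using le \<gamma> by simp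
    qed
  qed
  moreover have "excess S d 0 + 1 \<le> Max ?M" using fin by (intro Max_ge) auto
  moreover have "Max ?M \<le> max (peak S d 0) (excess S d 0 + 1)"
    using \<tau>_excess \<open>0 \<le> peak S d 0\<close> by (subst Max_le_iff) (auto simp: le_max_iff_disj)
  ultimately show ?thesis by (meson antisym max.boundedI)
qed

end

theorem theorem3p11:
  fixes d t s n :: nat and T :: "nat \<Rightarrow> nat" and P :: "nat list"
    and h l :: "nat \<Rightarrow> nat" and \<tau> :: "nat \<Rightarrow> int"
  assumes char: "CHAR('k::field) = 0 \<or> (infinite (UNIV :: 'k set) \<and> d < CHAR('k))"
    and "1 \<le> t" and "t \<le> d"
    and T: "T = (\<lambda>i. if i < d then i + 1 else if i = d then t else 0)"
    and s: "s = d + 1 - t"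
    and "is_partition P"
    and "diagonal_lengths TYPE('k) P = T"
    and code: "hook_code d P = concat (map (\<lambda>i. replicate (l i) (h i)) [1..<Suc n])"
    and "h 1 \<le> s"
    and "\<And>i j. 1 \<le> i \<Longrightarrow> i < j \<Longrightarrow> j \<le> n \<Longrightarrow> h j < h i"
    and "\<And>i. 1 \<le> i \<Longrightarrow> i \<le> n \<Longrightarrow> 1 \<le> l i"
    and \<tau>: "\<And>k. 1 \<le> k \<Longrightarrow> k \<le> n \<Longrightarrow> \<tau> k = (\<Sum>i = k..n. int (l i)) - int (h k)"
  shows "int (kappa TYPE('k) P) = int s + Max ({int t + 1 - int s, 0} \<union> \<tau> ` {1..n})"
proof -
  have inf: "infinite (UNIV :: 'k set)"
    using char finite_imp_CHAR_pos[where 'a = 'k] by auto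
  have diag: "card ({m. deg m = i} \<inter> cells P) = T i" for i
    using diagonal_lengths_eq[OF \<open>is_partition P\<close>, where 'k = 'k, of i] \<open>diagonal_lengths TYPE('k) P = T\<close> by simp
  interpret top_degree_cell P d
  proof
    fix m :: monomial assume m: "deg m < d"
    have "{m'. deg m' = deg m} \<inter> cells P = {m'. deg m' = deg m}"
      by (rule card_subset_eq[OF finite_deg]) (use diag[of "deg m"] m T card_deg[of "deg m"] in auto)
    then show "m \<in> cells P" by blast
  next
    fix m :: monomial assume m: "d < deg m"
    have "card ({m'. deg m' = deg m} \<inter> cells P) = 0" using diag[of "deg m"] m T by simp
    then have "{m'. deg m' = deg m} \<inter> cells P = {}" using finite_deg[of "deg m"] by simp
    then show "m \<notin> cells P" by blast
  qed
  have "bij_betw (\<lambda>b. (d - b, b)) ({..d} - S) ({m. deg m = d} \<inter> cells P)"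
    by (rule bij_betwI[where g = snd]) (auto simp: S_def prod_eq_iff)
  from bij_betw_same_card[OF this] have t: "card ({..d} - S) = t" using diag[of d] T by simp
  have "S \<subseteq> {..d}" using S_le by blast
  then have card_S: "card S = s" using t s card_Diff_subset[OF finite_S] card_mono[of "{..d}" S] by simp
  have "excess S d 0 = int t - int s"
  proof -
    have "{0..d} - S = {..d} - S" "{0..d} \<inter> S = S" using \<open>S \<subseteq> {..d}\<close> by auto
    then show ?thesis using t card_S by (simp add: excess_def)
  qed
  then have "excess S d 0 + 1 = int t + 1 - int s" by simp
  moreover have "Max ({excess S d 0 + 1, 0} \<union> \<tau> ` {1..n}) = max (peak S d 0) (excess S d 0 + 1)"
    by (rule max_excess_eq[OF code]) (use assms in auto)
  ultimately show ?thesis using kappa_eq[OF inf] card_S by simp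
qed

end
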